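(* Let $\beta$ be a positive braid on $n\ge 2$ strands with exponent sum (equivalently, number of crossings) $[\beta]$, whose closure $\hat\beta$ is a knot. Then $$v_2(\hat\beta)\,\ge\,\frac{[\beta]^2}{4n(n-1)}-\frac{(2n-3)(n-1)}{8}.$$
   Context: A positive braid is a word in the Artin generators $\sigma_i$ of the braid group $B_n$ with only positive exponents; $[\,\cdot\,]:B_n\to\mathbb{Z}$ is the homomorphism with $[\sigma_i]=1$. $\hat\beta$ is the closure of $\beta$. $v_2(K)$ is the Casson invariant: the coefficient of $z^2$ in the Conway polynomial $\nabla_K(z)$. *)

theory Defs
  imports Complex_Main "HOL-Computational_Algebra.Polynomial" "HOL-Combinatorics.Combinatorics"
begin

section \<open>Braid words\<close>

datatype letter = Sigma nat | Sigma_inv nat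

fun letter_index :: "letter \<Rightarrow> nat" where
  "letter_index (Sigma i) = i"
| "letter_index (Sigma_inv i) = i"

fun letter_sign :: "letter \<Rightarrow> int" where
  "letter_sign (Sigma i) = 1"
| "letter_sign (Sigma_inv i) = -1"

text \<open>The Artin generators of the braid group on \<open>n\<close> strands are numbered \<open>1, \<dots>, n - 1\<close>.\<close>

definition braid_word :: "nat \<Rightarrow> letter list \<Rightarrow> bool" where
  "braid_word n w \<longleftrightarrow> n \<ge> 1 \<and> (\<forall>l\<in>set w. 1 \<le> letter_index l \<and> letter_index l < n)"

definition positive_word :: "letter list \<Rightarrow> bool" where
  "positive_word w \<longleftrightarrow> (\<forall>l\<in>set w. letter_sign l = 1)"

definition exponent_sum :: "letter list \<Rightarrow> int" where
  "exponent_sum w = sum_list (map letter_sign w)"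

text \<open>Two words are related by \<open>braid_eq n\<close> iff they represent the same element of \<open>B\<^sub>n\<close>
  (Artin's presentation).\<close>

inductive braid_eq :: "nat \<Rightarrow> letter list \<Rightarrow> letter list \<Rightarrow> bool" for n where
  refl: "braid_word n w \<Longrightarrow> braid_eq n w w"
| sym: "braid_eq n v w \<Longrightarrow> braid_eq n w v"
| trans: "braid_eq n u v \<Longrightarrow> braid_eq n v w \<Longrightarrow> braid_eq n u w"
| mult: "braid_eq n u u' \<Longrightarrow> braid_eq n v v' \<Longrightarrow> braid_eq n (u @ v) (u' @ v')"
| right_inverse: "braid_word n [Sigma i] \<Longrightarrow> braid_eq n [Sigma i, Sigma_inv i] []"
| left_inverse: "braid_word n [Sigma i] \<Longrightarrow> braid_eq n [Sigma_inv i, Sigma i] []"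
| far_commute: "braid_word n [Sigma i, Sigma j] \<Longrightarrow> i + 2 \<le> j \<Longrightarrow>
    braid_eq n [Sigma i, Sigma j] [Sigma j, Sigma i]"
| braid_relation: "braid_word n [Sigma i, Sigma (i + 1)] \<Longrightarrow>
    braid_eq n [Sigma i, Sigma (i + 1), Sigma i] [Sigma (i + 1), Sigma i, Sigma (i + 1)]"

section \<open>Closures of braids and oriented links\<close>

text \<open>By the theorems of Alexander and Markov, taking closures identifies the isotopy classes of
  (nonempty) oriented links in the 3-sphere with the braids, on any number of strands, modulo
  conjugation and positive and negative stabilisation. Oriented links are therefore modelled as
  the classes of this relation. Moving a prefix of a word to its end is conjugation by that prefix.\<close>

inductive markov_eq :: "nat \<times> letter list \<Rightarrow> nat \<times> letter list \<Rightarrow> bool" where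
  braid: "braid_eq n v w \<Longrightarrow> markov_eq (n, v) (n, w)"
| sym: "markov_eq a b \<Longrightarrow> markov_eq b a"
| trans: "markov_eq a b \<Longrightarrow> markov_eq b c \<Longrightarrow> markov_eq a c"
| conjugation: "braid_word n (u @ v) \<Longrightarrow> markov_eq (n, u @ v) (n, v @ u)"
| pos_stabilisation: "braid_word n w \<Longrightarrow> markov_eq (n, w) (n + 1, w @ [Sigma n])"
| neg_stabilisation: "braid_word n w \<Longrightarrow> markov_eq (n, w) (n + 1, w @ [Sigma_inv n])"

quotient_type link = "nat \<times> letter list" / partial: markov_eq
proof (rule part_equivpI)
  have "braid_word 1 []" by (simp add: braid_word_def)
  then show "\<exists>x. markov_eq x x" by (blast intro: markov_eq.braid braid_eq.refl)
  show "symp markov_eq" by (blast intro: sympI markov_eq.sym)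
  show "transp markov_eq" by (blast intro: transpI markov_eq.trans)
qed

definition braid_closure :: "nat \<Rightarrow> letter list \<Rightarrow> link" where
  "braid_closure n w = abs_link (n, w)"

text \<open>Following the strands once through the braid permutes the endpoints \<open>1, \<dots>, n\<close>; the
  components of the closure correspond to the cycles of this permutation (fixed points included).\<close>

fun braid_perm :: "letter list \<Rightarrow> nat \<Rightarrow> nat" where
  "braid_perm [] = id"
| "braid_perm (l # w) = braid_perm w \<circ> transpose (letter_index l) (letter_index l + 1)"

definition closure_is_knot :: "nat \<Rightarrow> letter list \<Rightarrow> bool" where
  "closure_is_knot n w \<longleftrightarrow> card (orbit (braid_perm w) ` {1..n}) = 1"

section \<open>Conway polynomial and Casson invariant\<close>

definition unknot :: link where
  "unknot = braid_closure 1 []"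

text \<open>The Conway polynomial is the unique link invariant with value 1 on the unknot that satisfies
  \<open>\<nabla>(L\<^sub>+) - \<nabla>(L\<^sub>-) = z \<nabla>(L\<^sub>0)\<close> for every skein triple; the variable \<open>z\<close> is \<open>[:0, 1:]\<close>. Every
  skein triple of oriented links arises from a crossing of a closed braid.\<close>

definition is_conway :: "(link \<Rightarrow> int poly) \<Rightarrow> bool" where
  "is_conway C \<longleftrightarrow>
     C unknot = 1 \<and>
     (\<forall>n u v i. braid_word n (u @ [Sigma i] @ v) \<longrightarrow>
        C (braid_closure n (u @ [Sigma i] @ v)) - C (braid_closure n (u @ [Sigma_inv i] @ v))
          = [:0, 1:] * C (braid_closure n (u @ v)))"

definition conway :: "link \<Rightarrow> int poly" where
  "conway = (THE C. is_conway C)"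

definition v2 :: "link \<Rightarrow> int" where
  "v2 K = coeff (conway K) 2"

end

theory Submission
  imports Defs "Jordan_Normal_Form.Char_Poly"
begin

text \<open>The proof has two halves: the Conway polynomial has to be constructed, and its coefficient of
\<open>z\<^sup>2\<close> has to be estimated for positive braids.

\<^bold>\<open>Construction.\<close> \<^const>\<open>conway\<close> is a definite description. At most one invariant satisfies the
skein relation, because the relation computes every value: modulo shorter words the sign of a letter
does not matter, and the braid relations then turn any word on \<open>n + 1\<close> strands into one with at
most one letter of index \<open>n\<close>. Such a word either destabilises or has a split strand in its
closure, where every skein invariant vanishes (\<open>skein_computable_all\<close>). For existence, take the
Burau matrix \<open>B\<close> of a word at \<open>t = s\<^sup>2\<close>, delete the first row and column of \<open>1 - B\<close> and
multiply the determinant by a power of the real number \<open>s\<close>. The result is a Markov invariant and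
satisfies the skein relation with \<open>z = 1 / s - s\<close> (\<open>conway_value_markov\<close>,
\<open>conway_value_skein\<close>). By the computation just described it is the value at \<open>z\<close> of an integer
polynomial, and infinitely many \<open>z\<close> determine that polynomial.

\<^bold>\<open>Estimate.\<close> With \<open>x = 1 - t\<close>, the Burau matrix of \<open>\<sigma>\<^sub>i\<close> is a mixture, with weights
\<open>1 - x\<close> and \<open>x\<close>, of two maps: the transposition of \<open>i\<close> and \<open>i + 1\<close>, and the map that makes
both strands leave at position \<open>i\<close>, so that the strand coming from the left continues along the
other one. If the crossings get independent weights, the determinant is affine in each of them. At
weights \<open>0\<close> and \<open>1\<close> it is the determinant of a functional graph: it is \<open>1\<close> if every strand
eventually reaches the first one, and \<open>0\<close> otherwise. Write \<open>\<chi>(S)\<close> for its value when the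
crossings in \<open>S\<close> have weight \<open>1\<close> and the others \<open>0\<close>. Expanding to second order at \<open>x = 0\<close>
gives (\<open>v2_positive_braid\<close>)

  \<open>v\<^sub>2 = (\<Sum>k<l. \<chi>({k, l}) - \<chi>({k}) \<chi>({l}))\<close>.

Number the strands in the order in which the knot runs through them, and let \<open>a\<^sub>k\<close> and \<open>b\<^sub>k\<close> be the
left and the right strand at crossing \<open>k\<close>. Then \<open>\<chi>({k}) = 1\<close> iff \<open>a\<^sub>k\<close> comes before
\<open>b\<^sub>k\<close>. No summand is negative, and a pair \<open>k < l\<close> contributes \<open>1\<close> if the same two strands meet
at \<open>k\<close> and \<open>l\<close> with opposite sides and the later one is on the left at \<open>k\<close>
(\<open>v2_ge_backtracks\<close>). The reversed word has the same Conway polynomial, and its pairs are those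
with \<open>k > l\<close>. So \<open>2 v\<^sub>2\<close> is at least the number of all such pairs, which is the sum over pairs of
strands of \<open>N\<^sub>p\<^sub>q N\<^sub>q\<^sub>p\<close>, where \<open>N\<^sub>p\<^sub>q\<close> counts the crossings with \<open>p\<close> on the left and \<open>q\<close> on
the right (\<open>v2_ge_all_backtracks\<close>). Two strands change sides at each of their crossings, hence
\<open>N\<^sub>p\<^sub>q\<close> and \<open>N\<^sub>q\<^sub>p\<close> differ by at most \<open>1\<close> and their product is at least
\<open>((N\<^sub>p\<^sub>q + N\<^sub>q\<^sub>p)\<^sup>2 - 1) / 4\<close>. All crossings are counted once by the \<open>n (n - 1) / 2\<close> pairs, so the
Cauchy-Schwarz inequality yields

  \<open>v\<^sub>2 \<ge> [\<beta>]\<^sup>2 / (4 n (n - 1)) - n (n - 1) / 16\<close>,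

and \<open>n / 2 \<le> 2 n - 3\<close> for \<open>n \<ge> 2\<close>.\<close>

section \<open>Determinants and rank-one updates\<close>

text \<open>Both determinants are that of the block matrix with \<open>1\<close> on the diagonal and \<open>P\<close>, \<open>Q\<close> off it,
once by the Schur complement of either block.\<close>

lemma det_one_minus_mult_commute:
  fixes P Q :: "'a :: idom mat"
  assumes P: "P \<in> carrier_mat n n" and Q: "Q \<in> carrier_mat n n"
  shows "det (1\<^sub>m n - P * Q) = det (1\<^sub>m n - Q * P)"
proof -
  let ?F = "four_block_mat (1\<^sub>m n) P Q (1\<^sub>m n)"
  have PQ: "P * Q \<in> carrier_mat n n" "Q * P \<in> carrier_mat n n"
    using P Q by auto
  have "det ?F = det (1\<^sub>m n * 1\<^sub>m n - P * Q)"
    by (rule det_four_block_mat) (use P Q in auto)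
  then have 1: "det ?F = det (1\<^sub>m n - P * Q)" by simp
  have "four_block_mat (1\<^sub>m n) (0\<^sub>m n n) Q (1\<^sub>m n) * four_block_mat (1\<^sub>m n) P (0\<^sub>m n n) (1\<^sub>m n - Q * P)
      = four_block_mat (1\<^sub>m n * 1\<^sub>m n + 0\<^sub>m n n * 0\<^sub>m n n) (1\<^sub>m n * P + 0\<^sub>m n n * (1\<^sub>m n - Q * P))
          (Q * 1\<^sub>m n + 1\<^sub>m n * 0\<^sub>m n n) (Q * P + 1\<^sub>m n * (1\<^sub>m n - Q * P))"
    by (rule mult_four_block_mat) (use P Q in auto)
  also have "\<dots> = ?F"
  proof -
    have a: "1\<^sub>m n * P + 0\<^sub>m n n * (1\<^sub>m n - Q * P) = P"
    proof -
      have "0\<^sub>m n n * (1\<^sub>m n - Q * P) = 0\<^sub>m n n"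
        by (rule left_mult_zero_mat) (use P Q in auto)
      then show ?thesis using P by simp
    qed
    have b: "Q * P + 1\<^sub>m n * (1\<^sub>m n - Q * P) = 1\<^sub>m n"
    proof -
      have "1\<^sub>m n * (1\<^sub>m n - Q * P) = 1\<^sub>m n - Q * P"
        by (rule left_mult_one_mat) (use P Q in auto)
      moreover have "Q * P + (1\<^sub>m n - Q * P) = 1\<^sub>m n"
        by (rule eq_matI) (use P Q in auto)
      ultimately show ?thesis by simp
    qed
    have c: "Q * 1\<^sub>m n + 1\<^sub>m n * 0\<^sub>m n n = Q" "1\<^sub>m n * 1\<^sub>m n + 0\<^sub>m n n * 0\<^sub>m n n = (1\<^sub>m n :: 'a mat)"
      using Q by auto
    show ?thesis unfolding a b c ..
  qed
  finally have F: "?F = four_block_mat (1\<^sub>m n) (0\<^sub>m n n) Q (1\<^sub>m n)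
      * four_block_mat (1\<^sub>m n) P (0\<^sub>m n n) (1\<^sub>m n - Q * P)" ..
  have "det ?F = det (four_block_mat (1\<^sub>m n) (0\<^sub>m n n) Q (1\<^sub>m n))
      * det (four_block_mat (1\<^sub>m n) P (0\<^sub>m n n) (1\<^sub>m n - Q * P))"
    unfolding F by (rule det_mult[of _ "n + n"]; rule four_block_carrier_mat) (use P Q in auto)
  also have "det (four_block_mat (1\<^sub>m n) (0\<^sub>m n n) Q (1\<^sub>m n)) = 1"
    by (subst det_four_block_mat_upper_right_zero[of _ n _ n]) (use P Q in auto)
  also have "det (four_block_mat (1\<^sub>m n) P (0\<^sub>m n n) (1\<^sub>m n - Q * P)) = det (1\<^sub>m n - Q * P)"
    by (subst det_four_block_mat_lower_left_zero[of _ n _ n]) (use P Q in auto)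
  finally show ?thesis using 1 by simp
qed

text \<open>Border \<open>A\<close> by the column \<open>- x\<close>, the row \<open>y\<close> and the corner \<open>1\<close>. Column operations reduce the
bordered matrix to \<open>A + x y\<^sup>T\<close>, while its expansion along the last row is affine in \<open>y\<close>.\<close>

lemma det_rank_one_update:
  fixes A :: "nat \<Rightarrow> nat \<Rightarrow> 'a :: idom"
  shows "\<exists>w. \<forall>y. det (mat n n (\<lambda>(i, j). A i j + x i * y j))
      = det (mat n n (\<lambda>(i, j). A i j)) + (\<Sum>j<n. y j * w j)"
proof -
  define E where "E y = mat (Suc n) (Suc n) (\<lambda>(i, j).
      if i < n then (if j < n then A i j else - x i) else (if j < n then y j else 1))" for y
  define C where "C y = mat (Suc n) (Suc n) (\<lambda>(i, j).
      if i = j then 1 else if i = n then - y j else 0)" for y :: "nat \<Rightarrow> 'a"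
  have E: "E y \<in> carrier_mat (Suc n) (Suc n)" and C: "C y \<in> carrier_mat (Suc n) (Suc n)" for y
    by (auto simp: E_def C_def)
  have detC: "det (C y) = 1" for y
  proof -
    have "det (C y) = prod_list (diag_mat (C y))"
      by (rule det_lower_triangular[OF _ C]) (auto simp: C_def)
    also have "diag_mat (C y) = map (\<lambda>_. 1) [0..<Suc n]"
      unfolding diag_mat_def by (rule map_cong) (auto simp: C_def)
    also have "prod_list \<dots> = 1" by (induction n) auto
    finally show ?thesis .
  qed
  have EC: "E y * C y = mat (Suc n) (Suc n) (\<lambda>(i, j).
      if i < n then (if j < n then A i j + x i * y j else - x i) else if j < n then 0 else 1)" for y
  proof (rule eq_matI)
    fix i j assume "i < dim_row (mat (Suc n) (Suc n) (\<lambda>(i, j).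
        if i < n then (if j < n then A i j + x i * y j else - x i) else if j < n then 0 else 1))"
      and "j < dim_col (mat (Suc n) (Suc n) (\<lambda>(i, j).
        if i < n then (if j < n then A i j + x i * y j else - x i) else if j < n then 0 else 1))"
    then have i: "i < Suc n" and j: "j < Suc n" by auto
    have "(E y * C y) $$ (i, j) = (\<Sum>k<Suc n. E y $$ (i, k) * C y $$ (k, j))"
      using i j E[of y] C[of y] by (simp add: scalar_prod_def lessThan_atLeast0)
    also have "\<dots> = (\<Sum>k<n. E y $$ (i, k) * C y $$ (k, j)) + E y $$ (i, n) * C y $$ (n, j)"
      by simp
    also have "(\<Sum>k<n. E y $$ (i, k) * C y $$ (k, j)) = (\<Sum>k<n. if k = j then E y $$ (i, k) else 0)"
      using j by (intro sum.cong) (auto simp: C_def)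
    also have "\<dots> = (if j < n then E y $$ (i, j) else 0)"
      by (subst sum.delta) auto
    finally show "(E y * C y) $$ (i, j) = mat (Suc n) (Suc n) (\<lambda>(i, j).
        if i < n then (if j < n then A i j + x i * y j else - x i)
        else if j < n then 0 else 1) $$ (i, j)"
      using i j by (auto simp: E_def C_def)
  qed (auto simp: E_def C_def)
  have "det (mat n n (\<lambda>(i, j). A i j + x i * y j)) = det (E y * C y)" for y
  proof -
    have "E y * C y = four_block_mat (mat n n (\<lambda>(i, j). A i j + x i * y j))
        (mat n 1 (\<lambda>(i, j). - x i)) (0\<^sub>m 1 n) (1\<^sub>m 1)"
      unfolding EC by (rule eq_matI) (auto simp: four_block_mat_def Let_def)
    moreover have "det \<dots> = det (mat n n (\<lambda>(i, j). A i j + x i * y j)) * det (1\<^sub>m 1 :: 'a mat)"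
      by (rule det_four_block_mat_lower_left_zero) auto
    ultimately show ?thesis by simp
  qed
  also have "det (E y * C y) = det (E y)" for y
    by (simp add: det_mult[OF E C] detC)
  finally have step: "det (mat n n (\<lambda>(i, j). A i j + x i * y j)) = det (E y)" for y .
  define w where "w j = cofactor (E (\<lambda>_. 0)) n j" for j
  have "det (mat n n (\<lambda>(i, j). A i j + x i * y j))
      = det (mat n n (\<lambda>(i, j). A i j)) + (\<Sum>j<n. y j * w j)" for y
  proof -
    have cof: "cofactor (E y) n j = w j" if "j < Suc n" for j
    proof -
      have "mat_delete (E y) n j = mat_delete (E (\<lambda>_. 0)) n j"
        using that by (intro eq_matI) (auto simp: mat_delete_def E_def)
      then show ?thesis by (simp add: w_def cofactor_def)
    qed
    have "mat_delete (E (\<lambda>_. 0)) n n = mat n n (\<lambda>(i, j). A i j)"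
      by (intro eq_matI) (auto simp: mat_delete_def E_def)
    then have wn: "w n = det (mat n n (\<lambda>(i, j). A i j))"
      by (simp add: w_def cofactor_def flip: power_add mult_2)
    have "det (E y) = (\<Sum>j<Suc n. E y $$ (n, j) * cofactor (E y) n j)"
      by (rule laplace_expansion_row[OF E]) simp
    also have "\<dots> = (\<Sum>j<n. y j * w j) + w n"
      by (simp add: cof) (simp add: E_def)
    finally show ?thesis using step wn by simp
  qed
  then show ?thesis by blast
qed

lemma det_eq_0_kernel:
  fixes a :: "nat \<Rightarrow> nat \<Rightarrow> 'a :: idom"
  assumes "\<And>i. i < n \<Longrightarrow> (\<Sum>j<n. a i j * v j) = 0" and "k < n" "v k \<noteq> 0"
  shows "det (mat n n (\<lambda>(i, j). a i j)) = 0"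
proof -
  have "vec n v \<noteq> 0\<^sub>v n"
    using assms(2,3) by (metis index_vec index_zero_vec(1))
  moreover have "mat n n (\<lambda>(i, j). a i j) *\<^sub>v vec n v = 0\<^sub>v n"
    by (rule eq_vecI) (simp_all add: scalar_prod_def assms(1) flip: lessThan_atLeast0)
  ultimately show ?thesis
    by (subst det_0_iff_vec_prod_zero[of _ n]) (auto intro!: exI[of _ "vec n v"])
qed

text \<open>If \<open>v\<close> is in the kernel of \<open>a\<close>, then an update \<open>x y\<^sup>T\<close> with \<open>y \<bullet> v = 0\<close> keeps \<open>v\<close> in the
kernel, so the linear part of the update formula depends on \<open>y \<bullet> v\<close> only.\<close>

lemma det_rank_one_update_cong_right:
  fixes a :: "nat \<Rightarrow> nat \<Rightarrow> 'a :: idom"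
  assumes ker: "\<And>i. i < n \<Longrightarrow> (\<Sum>j<n. a i j * v j) = 0" and v: "k < n" "v k \<noteq> 0"
    and eq: "(\<Sum>j<n. y j * v j) = (\<Sum>j<n. y' j * v j)"
  shows "det (mat n n (\<lambda>(i, j). a i j + x i * y j)) = det (mat n n (\<lambda>(i, j). a i j + x i * y' j))"
proof -
  obtain w where w: "\<And>y. det (mat n n (\<lambda>(i, j). a i j + x i * y j))
      = det (mat n n (\<lambda>(i, j). a i j)) + (\<Sum>j<n. y j * w j)"
    using det_rank_one_update[of n a x] by blast
  have "det (mat n n (\<lambda>(i, j). a i j + x i * (y j - y' j))) = 0"
  proof (rule det_eq_0_kernel[where v = v and k = k])
    fix i assume "i < n"
    have "(\<Sum>j<n. (a i j + x i * (y j - y' j)) * v j)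
        = (\<Sum>j<n. a i j * v j) + x i * ((\<Sum>j<n. y j * v j) - (\<Sum>j<n. y' j * v j))"
      by (simp add: algebra_simps sum.distrib sum_subtractf sum_distrib_left)
    then show "(\<Sum>j<n. (a i j + x i * (y j - y' j)) * v j) = 0"
      using ker[OF \<open>i < n\<close>] eq by simp
  qed (use v in auto)
  moreover have "det (mat n n (\<lambda>(i, j). a i j)) = 0"
    by (rule det_eq_0_kernel[where v = v and k = k]) (use ker v in auto)
  ultimately have "(\<Sum>j<n. (y j - y' j) * w j) = 0"
    using w[of "\<lambda>j. y j - y' j"] by simp
  then show ?thesis
    by (simp add: w algebra_simps sum_subtractf)
qed

lemma det_rank_one_update_cong_left:
  fixes a :: "nat \<Rightarrow> nat \<Rightarrow> 'a :: idom"
  assumes ker: "\<And>j. j < n \<Longrightarrow> (\<Sum>i<n. u i * a i j) = 0" and u: "k < n" "u k \<noteq> 0"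
    and eq: "(\<Sum>i<n. u i * x i) = (\<Sum>i<n. u i * x' i)"
  shows "det (mat n n (\<lambda>(i, j). a i j + x i * y j)) = det (mat n n (\<lambda>(i, j). a i j + x' i * y j))"
proof -
  have tr: "det (mat n n (\<lambda>(i, j). a i j + x i * y j)) = det (mat n n (\<lambda>(i, j). a j i + y i * x j))"
    for x
  proof -
    have "(mat n n (\<lambda>(i, j). a i j + x i * y j))\<^sup>T = mat n n (\<lambda>(i, j). a j i + y i * x j)"
      by (rule eq_matI) (auto simp: mult.commute)
    then show ?thesis
      using det_transpose[of "mat n n (\<lambda>(i, j). a i j + x i * y j)" n] by simp
  qed
  show ?thesis unfolding tr
    by (rule det_rank_one_update_cong_right[where v = u])
      (use assms in \<open>auto simp: mult.commute\<close>)
qed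

text \<open>Deleting the first row and column of \<open>1 - B\<close> amounts to cutting the first column off \<open>B\<close>, which
is what \<open>K\<close> does. The matrix \<open>1 - P Q\<close> has the kernel vector \<open>1\<close> and the left kernel vector \<open>u\<close>.
Both \<open>1 - P Q K\<close> and \<open>1 - P K Q\<close> are rank-one updates of it, by \<open>P Q e\<^sub>0 e\<^sub>0\<^sup>T\<close> and by
\<open>P e\<^sub>0 e\<^sub>0\<^sup>T Q\<close>, whose factors have the same pairings with these two vectors. Hence the two
determinants agree, and \<open>P K\<close> can be moved past \<open>Q\<close> cyclically.\<close>

lemma det_absorbed_commute:
  fixes P Q :: "'a :: idom mat"
  assumes P: "P \<in> carrier_mat n n" and Q: "Q \<in> carrier_mat n n" and n: "0 < n" and u0: "u 0 \<noteq> 0"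
    and P1: "\<And>i. i < n \<Longrightarrow> (\<Sum>j<n. P $$ (i, j)) = 1" and Q1: "\<And>i. i < n \<Longrightarrow> (\<Sum>j<n. Q $$ (i, j)) = 1"
    and uP: "\<And>j. j < n \<Longrightarrow> (\<Sum>i<n. u i * P $$ (i, j)) = u j"
    and uQ: "\<And>j. j < n \<Longrightarrow> (\<Sum>i<n. u i * Q $$ (i, j)) = u j"
  defines "K \<equiv> mat n n (\<lambda>(i, j). of_bool (i = j \<and> j \<noteq> 0))"
  shows "det (1\<^sub>m n - P * Q * K) = det (1\<^sub>m n - Q * P * K)"
proof -
  define a where "a i j = of_bool (i = j) - (P * Q) $$ (i, j)" for i j
  have K: "K \<in> carrier_mat n n" by (simp add: K_def)
  have mult: "(X * Y) $$ (i, j) = (\<Sum>k<n. X $$ (i, k) * Y $$ (k, j))"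
    if "X \<in> carrier_mat n n" "Y \<in> carrier_mat n n" "i < n" "j < n" for X Y i j
    using that by (simp add: scalar_prod_def lessThan_atLeast0)
  note PQ = mult[OF P Q]
  have XK: "(X * K) $$ (i, j) = (if j = 0 then 0 else X $$ (i, j))"
    if "X \<in> carrier_mat n n" "i < n" "j < n" for X i j
  proof -
    have "(X * K) $$ (i, j) = (\<Sum>k<n. X $$ (i, k) * of_bool (k = j \<and> j \<noteq> 0))"
      using that by (simp add: scalar_prod_def lessThan_atLeast0 K_def)
    also have "\<dots> = (\<Sum>k<n. if k = j then (if j = 0 then 0 else X $$ (i, j)) else 0)"
      by (intro sum.cong) auto
    also have "\<dots> = (if j = 0 then 0 else X $$ (i, j))"
      using that by (subst sum.delta) auto
    finally show ?thesis .
  qed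
  have row: "(\<Sum>j<n. a i j * 1) = 0" if "i < n" for i
  proof -
    have "(\<Sum>j<n. (P * Q) $$ (i, j)) = (\<Sum>j<n. \<Sum>k<n. P $$ (i, k) * Q $$ (k, j))"
      using that by (simp add: PQ)
    also have "\<dots> = (\<Sum>k<n. P $$ (i, k) * (\<Sum>j<n. Q $$ (k, j)))"
      by (subst sum.swap) (simp add: sum_distrib_left)
    also have "\<dots> = 1" using that by (simp add: Q1 P1)
    finally have "(\<Sum>j<n. (P * Q) $$ (i, j)) = 1" .
    moreover have "(\<Sum>j<n. of_bool (i = j) :: 'a) = 1"
      using that by (simp add: of_bool_def)
    ultimately show ?thesis by (simp add: a_def sum_subtractf)
  qed
  have uPQ: "(\<Sum>i<n. u i * (P * Q) $$ (i, j)) = u j" if "j < n" for j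
  proof -
    have "(\<Sum>i<n. u i * (P * Q) $$ (i, j)) = (\<Sum>i<n. \<Sum>k<n. u i * P $$ (i, k) * Q $$ (k, j))"
      using that by (simp add: PQ sum_distrib_left mult.assoc)
    also have "\<dots> = (\<Sum>k<n. (\<Sum>i<n. u i * P $$ (i, k)) * Q $$ (k, j))"
      by (subst sum.swap) (simp add: sum_distrib_right)
    also have "\<dots> = u j" using that by (simp add: uP uQ)
    finally show ?thesis .
  qed
  have col: "(\<Sum>i<n. u i * a i j) = 0" if "j < n" for j
  proof -
    have "(\<Sum>i<n. u i * of_bool (i = j)) = (\<Sum>i<n. if i = j then u j else 0)"
      by (intro sum.cong) auto
    then have "(\<Sum>i<n. u i * of_bool (i = j)) = u j" using that by simp
    then show ?thesis using uPQ[OF that] by (simp add: a_def sum_subtractf right_diff_distrib)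
  qed
  have "1\<^sub>m n - P * Q * K = mat n n (\<lambda>(i, j). a i j + (P * Q) $$ (i, 0) * of_bool (j = 0))"
    by (rule eq_matI)
      (use P Q K n in \<open>auto simp: a_def XK[of "P * Q"] simp del: index_mult_mat(1) assoc_mult_mat\<close>)
  then have "det (1\<^sub>m n - P * Q * K)
      = det (mat n n (\<lambda>(i, j). a i j + (P * Q) $$ (i, 0) * of_bool (j = 0)))" by simp
  also have "\<dots> = det (mat n n (\<lambda>(i, j). a i j + P $$ (i, 0) * of_bool (j = 0)))"
    by (rule det_rank_one_update_cong_left[where u = u])
      (use n u0 in \<open>simp_all only: col uPQ uP\<close>)
  also have "\<dots> = det (mat n n (\<lambda>(i, j). a i j + P $$ (i, 0) * Q $$ (0, j)))"
  proof (rule det_rank_one_update_cong_right[where v = "\<lambda>_. 1"])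
    have "(\<Sum>j<n. of_bool (j = 0) :: 'a) = (\<Sum>j<n. if j = 0 then 1 else 0)"
      by (intro sum.cong) auto
    then show "(\<Sum>j<n. of_bool (j = 0) * 1) = (\<Sum>j<n. Q $$ (0, j) * 1)"
      using n by (simp add: Q1)
  qed (use n row in auto)
  also have "mat n n (\<lambda>(i, j). a i j + P $$ (i, 0) * Q $$ (0, j)) = 1\<^sub>m n - P * K * Q"
  proof (rule eq_matI)
    fix i j assume "i < dim_row (1\<^sub>m n - P * K * Q)" "j < dim_col (1\<^sub>m n - P * K * Q)"
    then have ij: "i < n" "j < n" using P Q K by auto
    have "(P * K * Q) $$ (i, j) = (\<Sum>k<n. (P * K) $$ (i, k) * Q $$ (k, j))"
      by (rule mult) (use ij P Q K in auto)
    also have "\<dots> = (\<Sum>k<n. P $$ (i, k) * Q $$ (k, j) - (if k = 0 then P $$ (i, 0) * Q $$ (0, j) else 0))"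
      using ij by (intro sum.cong) (auto simp: XK[OF P])
    also have "\<dots> = (P * Q) $$ (i, j) - P $$ (i, 0) * Q $$ (0, j)"
      using ij n by (simp add: sum_subtractf PQ)
    finally have PKQ: "(P * K * Q) $$ (i, j) = (P * Q) $$ (i, j) - P $$ (i, 0) * Q $$ (0, j)" .
    have "(1\<^sub>m n - P * K * Q) $$ (i, j) = of_bool (i = j) - (P * K * Q) $$ (i, j)"
      using ij P Q K by (subst index_minus_mat) auto
    then show "mat n n (\<lambda>(i, j). a i j + P $$ (i, 0) * Q $$ (0, j)) $$ (i, j) = (1\<^sub>m n - P * K * Q) $$ (i, j)"
      using ij by (simp add: PKQ a_def)
  qed (use P Q K in auto)
  also have "det (1\<^sub>m n - P * K * Q) = det (1\<^sub>m n - Q * (P * K))"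
    by (rule det_one_minus_mult_commute) (use P Q K in auto)
  also have "Q * (P * K) = Q * P * K"
    by (rule assoc_mult_mat[symmetric]) (use P Q K in auto)
  finally show ?thesis .
qed

section \<open>Operators on strands and absorbed determinants\<close>

definition unit_fun :: "nat \<Rightarrow> nat \<Rightarrow> real" where
  "unit_fun j = (\<lambda>i. of_bool (i = j))"

text \<open>Braids act on functions on all positions \<open>0, 1, 2, \<dots>\<close> rather than on vectors of length \<open>n\<close>: the
operators of a word are then the same for every number of strands, and the braid relations are
pointwise identities. Matrices appear only when a determinant is taken.\<close>

definition linear_op :: "((nat \<Rightarrow> real) \<Rightarrow> nat \<Rightarrow> real) \<Rightarrow> bool" where
  "linear_op T \<longleftrightarrow> (\<forall>a b f g. T (\<lambda>p. a * f p + b * g p) = (\<lambda>p. a * T f p + b * T g p))"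

definition matrix_on :: "nat \<Rightarrow> ((nat \<Rightarrow> real) \<Rightarrow> nat \<Rightarrow> real) \<Rightarrow> bool" where
  "matrix_on n T \<longleftrightarrow>
     (\<forall>f. \<forall>i\<in>{1..n}. T f i = (\<Sum>j\<in>{1..n}. f j * T (unit_fun j) i))"

definition matrix_of :: "nat \<Rightarrow> ((nat \<Rightarrow> real) \<Rightarrow> nat \<Rightarrow> real) \<Rightarrow> real mat" where
  "matrix_of n T = mat n n (\<lambda>(i, j). T (unit_fun (Suc j)) (Suc i))"

text \<open>The minor of \<open>1 - T\<close> without the row and column of position \<open>1\<close>. If \<open>T\<close> is read as one step of a
random walk on positions, this is the walk absorbed at position \<open>1\<close>. The matrix indices start at
\<open>0\<close>, which accounts for the shift by two.\<close>

definition absorbed_det :: "nat \<Rightarrow> ((nat \<Rightarrow> real) \<Rightarrow> nat \<Rightarrow> real) \<Rightarrow> real" where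
  "absorbed_det n T = det (mat (n - 1) (n - 1) (\<lambda>(i, j).
     of_bool (i = j) - T (unit_fun (Suc (Suc j))) (Suc (Suc i))))"

lemma linear_opD:
  "linear_op T \<Longrightarrow> T (\<lambda>p. a * f p + b * g p) = (\<lambda>p. a * T f p + b * T g p)"
  by (auto simp: linear_op_def)

lemma linear_op_comp: "linear_op S \<Longrightarrow> linear_op T \<Longrightarrow> linear_op (\<lambda>f. S (T f))"
  by (simp add: linear_op_def)

lemma sum_atLeast1_atMost: "(\<Sum>j\<in>{1..n}. f j) = (\<Sum>j<n. f (Suc j))"
  by (rule sum.reindex_bij_witness[of _ Suc "\<lambda>j. j - 1"]) auto

lemma sum_unit_fun:
  "p \<in> A \<Longrightarrow> finite A \<Longrightarrow> (\<Sum>j\<in>A. f j * unit_fun j p) = f p"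
  by (simp add: unit_fun_def of_bool_def if_distrib sum.delta cong: if_cong)

lemma matrix_on_comp:
  assumes "matrix_on n S" "matrix_on n T"
  shows "matrix_on n (\<lambda>f. S (T f))"
  unfolding matrix_on_def
proof (intro allI ballI)
  fix f i assume i: "i \<in> {1..n}"
  have "S (T f) i = (\<Sum>j\<in>{1..n}. T f j * S (unit_fun j) i)"
    using assms(1) i by (simp add: matrix_on_def)
  also have "\<dots> = (\<Sum>j\<in>{1..n}. (\<Sum>k\<in>{1..n}. f k * T (unit_fun k) j) * S (unit_fun j) i)"
    using assms(2) unfolding matrix_on_def by (intro sum.cong) auto
  also have "\<dots> = (\<Sum>k\<in>{1..n}. f k * (\<Sum>j\<in>{1..n}. T (unit_fun k) j * S (unit_fun j) i))"
    by (simp add: sum_distrib_left sum_distrib_right mult.assoc) (rule sum.swap)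
  also have "\<dots> = (\<Sum>k\<in>{1..n}. f k * S (T (unit_fun k)) i)"
    using assms(1) i unfolding matrix_on_def by (intro sum.cong) auto
  finally show "S (T f) i = (\<Sum>j\<in>{1..n}. f j * S (T (unit_fun j)) i)" .
qed

lemma matrix_of_carrier: "matrix_of n T \<in> carrier_mat n n"
  by (simp add: matrix_of_def)

lemma matrix_of_comp:
  assumes "matrix_on n S"
  shows "matrix_of n (\<lambda>f. S (T f)) = matrix_of n S * matrix_of n T"
proof (rule eq_matI)
  fix i j assume "i < dim_row (matrix_of n S * matrix_of n T)"
    "j < dim_col (matrix_of n S * matrix_of n T)"
  then have ij: "i < n" "j < n" by (auto simp: matrix_of_def)
  then have "matrix_of n (\<lambda>f. S (T f)) $$ (i, j) = S (T (unit_fun (Suc j))) (Suc i)"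
    by (simp add: matrix_of_def)
  also have "\<dots> = (\<Sum>k<n. T (unit_fun (Suc j)) (Suc k) * S (unit_fun (Suc k)) (Suc i))"
    using assms ij unfolding matrix_on_def sum_atLeast1_atMost by auto
  also have "\<dots> = (matrix_of n S * matrix_of n T) $$ (i, j)"
    using ij by (simp add: matrix_of_def scalar_prod_def lessThan_atLeast0 mult.commute)
  finally show "matrix_of n (\<lambda>f. S (T f)) $$ (i, j) = (matrix_of n S * matrix_of n T) $$ (i, j)" .
qed (auto simp: matrix_of_def)

lemma absorbed_det_eq:
  assumes "0 < n"
  shows "absorbed_det n T
    = det (1\<^sub>m n - matrix_of n T * mat n n (\<lambda>(i, j). of_bool (i = j \<and> j \<noteq> 0)))"
proof -
  obtain m where m: "n = Suc m" using assms by (cases n) auto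
  let ?K = "mat n n (\<lambda>(i, j). of_bool (i = j \<and> j \<noteq> 0)) :: real mat"
  have TK: "(matrix_of n T * ?K) $$ (i, j) = (if j = 0 then 0 else T (unit_fun (Suc j)) (Suc i))"
    if "i < n" "j < n" for i j
  proof -
    have "(matrix_of n T * ?K) $$ (i, j)
        = (\<Sum>k<n. T (unit_fun (Suc k)) (Suc i) * of_bool (k = j \<and> j \<noteq> 0))"
      using that by (simp add: scalar_prod_def lessThan_atLeast0 matrix_of_def)
    also have "\<dots> = (\<Sum>k<n. if k = j then (if j = 0 then 0 else T (unit_fun (Suc j)) (Suc i)) else 0)"
      by (intro sum.cong) auto
    also have "\<dots> = (if j = 0 then 0 else T (unit_fun (Suc j)) (Suc i))"
      using that by (subst sum.delta) auto
    finally show ?thesis .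
  qed
  have "1\<^sub>m n - matrix_of n T * ?K
      = four_block_mat (1\<^sub>m 1) (mat 1 m (\<lambda>(i, j). - T (unit_fun (Suc (Suc j))) (Suc i))) (0\<^sub>m m 1)
          (mat m m (\<lambda>(i, j). of_bool (i = j) - T (unit_fun (Suc (Suc j))) (Suc (Suc i))))"
    (is "?L = ?R")
  proof (rule eq_matI)
    fix i j assume "i < dim_row ?R" "j < dim_col ?R"
    then have ij: "i < n" "j < n" by (auto simp: m)
    then have "?L $$ (i, j) = of_bool (i = j) - (if j = 0 then 0 else T (unit_fun (Suc j)) (Suc i))"
      by (subst TK[symmetric]) (auto simp: matrix_of_def)
    also have "\<dots> = ?R $$ (i, j)"
      using ij by (cases i; cases j) (auto simp: m)
    finally show "?L $$ (i, j) = ?R $$ (i, j)" .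
  qed (auto simp: m matrix_of_def)
  moreover have "det ?R = det (1\<^sub>m 1 :: real mat)
      * det (mat m m (\<lambda>(i, j). of_bool (i = j) - T (unit_fun (Suc (Suc j))) (Suc (Suc i))))"
    by (rule det_four_block_mat_lower_left_zero) auto
  ultimately show ?thesis
    unfolding absorbed_det_def m diff_Suc_1 by (simp del: One_nat_def)
qed

text \<open>The transposed Burau operators fix the geometric vector \<open>(t, t\<^sup>2, \<dots>)\<close>, so the matrix lemma above applies
with \<open>u\<close> this vector.\<close>

lemma absorbed_det_commute:
  assumes "matrix_on n S" "matrix_on n T" and n: "0 < n" and t: "t \<noteq> 0"
    and "S (\<lambda>_. 1) = (\<lambda>_. 1)" "T (\<lambda>_. 1) = (\<lambda>_. 1)"
    and "\<And>f. (\<Sum>i\<in>{1..n}. t ^ i * S f i) = (\<Sum>i\<in>{1..n}. t ^ i * f i)"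
    and "\<And>f. (\<Sum>i\<in>{1..n}. t ^ i * T f i) = (\<Sum>i\<in>{1..n}. t ^ i * f i)"
  shows "absorbed_det n (\<lambda>f. S (T f)) = absorbed_det n (\<lambda>f. T (S f))"
proof -
  have row: "(\<Sum>j<n. matrix_of n R $$ (i, j)) = 1"
    if "matrix_on n R" "R (\<lambda>_. 1) = (\<lambda>_. 1)" "i < n" for R i
  proof -
    have "(\<Sum>j<n. matrix_of n R $$ (i, j)) = (\<Sum>j\<in>{1..n}. 1 * R (unit_fun j) (Suc i))"
      using that(3) unfolding sum_atLeast1_atMost by (auto simp: matrix_of_def)
    also have "\<dots> = R (\<lambda>_. 1) (Suc i)"
      using that(1,3) unfolding matrix_on_def by (subst that(1)[unfolded matrix_on_def, rule_format]) auto
    finally show ?thesis using that(2) by simp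
  qed
  have col: "(\<Sum>i<n. t ^ Suc i * matrix_of n R $$ (i, j)) = t ^ Suc j"
    if "\<And>f. (\<Sum>i\<in>{1..n}. t ^ i * R f i) = (\<Sum>i\<in>{1..n}. t ^ i * f i)" "j < n" for R j
  proof -
    have "(\<Sum>i<n. t ^ Suc i * matrix_of n R $$ (i, j)) = (\<Sum>i\<in>{1..n}. t ^ i * R (unit_fun (Suc j)) i)"
      using that(2) unfolding sum_atLeast1_atMost by (auto simp: matrix_of_def)
    also have "\<dots> = (\<Sum>i\<in>{1..n}. t ^ i * unit_fun (Suc j) i)"
      by (rule that(1))
    also have "\<dots> = (\<Sum>i\<in>{1..n}. t ^ i * unit_fun i (Suc j))"
      by (rule sum.cong) (auto simp: unit_fun_def)
    also have "\<dots> = t ^ Suc j" using that(2) by (subst sum_unit_fun) auto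
    finally show ?thesis .
  qed
  show ?thesis
    unfolding absorbed_det_eq[OF n] matrix_of_comp[OF assms(1), of T]
      matrix_of_comp[OF assms(2), of S]
    by (rule det_absorbed_commute[where u = "\<lambda>i. t ^ Suc i"])
      (simp_all only: row[OF assms(1,5)] row[OF assms(2,6)] col[OF assms(7)] col[OF assms(8)]
        matrix_of_carrier n, use t in auto)
qed

text \<open>This is the source of every linearity statement below: a crossing enters the operator of a word only
through a term of rank one.\<close>

lemma absorbed_det_rank_one:
  "\<exists>W. \<forall>c. absorbed_det n (\<lambda>f p. S f p + c * y f * x p) = absorbed_det n S + c * W"
proof -
  obtain w where w: "\<And>y. det (mat (n - 1) (n - 1) (\<lambda>(i, j).
        (of_bool (i = j) - S (unit_fun (Suc (Suc j))) (Suc (Suc i))) + (- x (Suc (Suc i))) * y j))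
      = absorbed_det n S + (\<Sum>j<n - 1. y j * w j)"
    using det_rank_one_update[of "n - 1"
        "\<lambda>i j. of_bool (i = j) - S (unit_fun (Suc (Suc j))) (Suc (Suc i))" "\<lambda>i. - x (Suc (Suc i))"]
    unfolding absorbed_det_def by blast
  have "absorbed_det n (\<lambda>f p. S f p + c * y f * x p)
      = absorbed_det n S + c * (\<Sum>j<n - 1. y (unit_fun (Suc (Suc j))) * w j)" for c
    using w[of "\<lambda>j. c * y (unit_fun (Suc (Suc j)))"] unfolding absorbed_det_def
    by (simp add: algebra_simps sum_distrib_left)
  then show ?thesis by blast
qed

text \<open>Adding the last column to the one before it restores the matrix of \<open>T\<close>, because \<open>a + c = 1\<close>, and
clears the last row up to the corner \<open>1 - d\<close>, because \<open>b + d = 1\<close>.\<close>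

lemma absorbed_det_stabilise:
  assumes T: "linear_op T" "T (unit_fun (Suc n)) = unit_fun (Suc n)" "\<And>f. T f (Suc n) = f (Suc n)"
    and L: "\<And>j. j < n \<Longrightarrow> L (unit_fun j) = unit_fun j"
      "L (unit_fun n) = (\<lambda>p. a * unit_fun n p + b * unit_fun (Suc n) p)"
      "L (unit_fun (Suc n)) = (\<lambda>p. c * unit_fun n p + d * unit_fun (Suc n) p)"
    and ab: "a + c = 1" "b + d = 1" and n: "0 < n"
  shows "absorbed_det (Suc n) (\<lambda>f. T (L f)) = (1 - d) * absorbed_det n T"
proof -
  obtain m where m: "n = Suc m" using n by (cases n) auto
  define X where "X = mat n n (\<lambda>(i, j). of_bool (i = j) - T (L (unit_fun (Suc (Suc j)))) (Suc (Suc i)))"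
  define C where "C = mat n n (\<lambda>(i, j). of_bool (i = j \<or> i = m \<and> Suc j = m) :: real)"
  have X: "X \<in> carrier_mat n n" and C: "C \<in> carrier_mat n n" by (auto simp: X_def C_def)
  have Xe: "X $$ (i, j) = of_bool (i = j) - (if Suc j < m then T (unit_fun (Suc (Suc j))) (Suc (Suc i))
      else if Suc j = m then a * T (unit_fun n) (Suc (Suc i)) + b * of_bool (i = m)
      else c * T (unit_fun n) (Suc (Suc i)) + d * of_bool (i = m))" if ij: "i < n" "j < n" for i j
  proof -
    have 1: "T (L (unit_fun n)) = (\<lambda>p. a * T (unit_fun n) p + b * unit_fun (Suc n) p)"
      "T (L (unit_fun (Suc n))) = (\<lambda>p. c * T (unit_fun n) p + d * unit_fun (Suc n) p)"
      by (simp_all add: L linear_opD[OF T(1)] T(2))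
    have "T (L (unit_fun (Suc (Suc j)))) (Suc (Suc i)) = (if Suc j < m then T (unit_fun (Suc (Suc j))) (Suc (Suc i))
      else if Suc j = m then a * T (unit_fun n) (Suc (Suc i)) + b * of_bool (i = m)
      else c * T (unit_fun n) (Suc (Suc i)) + d * of_bool (i = m))"
    proof (cases "Suc j < m")
      case True
      then show ?thesis using L(1)[of "Suc (Suc j)"] m by simp
    next
      case False
      then consider "Suc (Suc j) = n" "Suc j = m" | "Suc (Suc j) = Suc n" "j = m"
        using ij m by linarith
      then show ?thesis
      proof cases
        case 1
        show ?thesis using 1(2) m \<open>T (L (unit_fun n)) = _\<close> unfolding 1(1)
          by (simp add: unit_fun_def)
      next
        case 2
        show ?thesis using 2(2) m \<open>T (L (unit_fun (Suc n))) = _\<close> unfolding 2(1)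
          by (simp add: unit_fun_def)
      qed
    qed
    then show ?thesis using that by (simp add: X_def)
  qed
  have detC: "det C = 1"
  proof -
    have "det C = prod_list (diag_mat C)"
      by (rule det_lower_triangular[OF _ C]) (auto simp: C_def)
    also have "diag_mat C = map (\<lambda>_. 1) [0..<n]"
      unfolding diag_mat_def by (rule map_cong) (auto simp: C_def)
    also have "prod_list \<dots> = 1" by (induction n) auto
    finally show ?thesis .
  qed
  have XC: "(X * C) $$ (i, j) = X $$ (i, j) + (if Suc j = m then X $$ (i, m) else 0)"
    if "i < n" "j < n" for i j
  proof -
    have "(X * C) $$ (i, j) = (\<Sum>k<n. X $$ (i, k) * C $$ (k, j))"
      using that X C by (simp add: scalar_prod_def lessThan_atLeast0)
    also have "\<dots> = (\<Sum>k<n. (if k = j then X $$ (i, j) else 0)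
        + (if k = m then (if Suc j = m then X $$ (i, m) else 0) else 0))"
      using that by (intro sum.cong) (auto simp: C_def)
    also have "\<dots> = X $$ (i, j) + (if Suc j = m then X $$ (i, m) else 0)"
      using that m by (simp add: sum.distrib)
    finally show ?thesis .
  qed
  have "X * C = four_block_mat
      (mat m m (\<lambda>(i, j). of_bool (i = j) - T (unit_fun (Suc (Suc j))) (Suc (Suc i))))
      (mat m 1 (\<lambda>(i, j). X $$ (i, m))) (0\<^sub>m 1 m) (mat 1 1 (\<lambda>_. 1 - d))" (is "_ = ?R")
  proof (rule eq_matI)
    fix i j assume "i < dim_row ?R" "j < dim_col ?R"
    then have ij: "i < n" "j < n" by (auto simp: m)
    have split: "a * v + c * v = v" for v using ab by (metis distrib_right mult_1)
    have T': "T (unit_fun k) (Suc (Suc m)) = of_bool (k = Suc n)" for k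
      using T(3)[of "unit_fun k"] by (auto simp: m unit_fun_def)
    consider "i < m" "Suc j < m" | "i < m" "Suc j = m" | "i < m" "j = m"
      | "i = m" "Suc j < m" | "i = m" "Suc j = m" | "i = m" "j = m"
      using ij m by linarith
    then show "(X * C) $$ (i, j) = ?R $$ (i, j)"
      unfolding XC[OF ij]
    proof cases
      case 2
      then have "Suc (Suc j) = n" using m by simp
      then show "X $$ (i, j) + (if Suc j = m then X $$ (i, m) else 0) = ?R $$ (i, j)"
        using 2 ij split[of "T (unit_fun n) (Suc (Suc i))"] by (auto simp: Xe m)
    qed (use ij ab m in \<open>auto simp: Xe T'\<close>)
  qed (use X C m in auto)
  then have "det (X * C) = absorbed_det n T * det (mat 1 1 (\<lambda>_. 1 - d))"
    unfolding absorbed_det_def m diff_Suc_1 by (simp add: det_four_block_mat_lower_left_zero[of _ m _ 1])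
  also have "det (mat 1 1 (\<lambda>_. 1 - d)) = 1 - d"
    by (subst det_single) auto
  finally show ?thesis
    unfolding absorbed_det_def[of "Suc n"] det_mult[OF X C] detC by (simp add: X_def)
qed

section \<open>Words\<close>

lemma exponent_sum_simps [simp]:
  "exponent_sum [] = 0" "exponent_sum (l # w) = letter_sign l + exponent_sum w"
  "exponent_sum (u @ v) = exponent_sum u + exponent_sum v"
  by (simp_all add: exponent_sum_def)

lemma braid_word_append [simp]:
  "braid_word n (u @ v) \<longleftrightarrow> braid_word n u \<and> braid_word n v"
  by (auto simp: braid_word_def)

lemma braid_word_Cons:
  "braid_word n (l # w) \<longleftrightarrow> braid_word n w \<and> 1 \<le> letter_index l \<and> letter_index l < n"
  by (auto simp: braid_word_def)

lemma braid_word_Nil [simp]: "braid_word n [] \<longleftrightarrow> 1 \<le> n"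
  by (auto simp: braid_word_def)

lemma braid_eq_imp_braid_word: "braid_eq n v w \<Longrightarrow> braid_word n v \<and> braid_word n w"
  by (induction rule: braid_eq.induct) (auto simp: braid_word_Cons)

lemma braid_eq_exponent_sum: "braid_eq n v w \<Longrightarrow> exponent_sum v = exponent_sum w"
  by (induction rule: braid_eq.induct) auto

section \<open>The Burau representation and its skein invariant\<close>

text \<open>The unreduced Burau representation, with block \<open>(1 - t, t; 1, 0)\<close> at the positions \<open>i\<close>, \<open>i + 1\<close> and
its inverse.\<close>

fun burau_letter :: "real \<Rightarrow> letter \<Rightarrow> (nat \<Rightarrow> real) \<Rightarrow> nat \<Rightarrow> real" where
  "burau_letter t (Sigma i) f = f(i := (1 - t) * f i + t * f (Suc i), Suc i := f i)"
| "burau_letter t (Sigma_inv i) f = f(i := f (Suc i), Suc i := f i / t + (1 - 1 / t) * f (Suc i))"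

abbreviation burau :: "real \<Rightarrow> letter list \<Rightarrow> (nat \<Rightarrow> real) \<Rightarrow> nat \<Rightarrow> real" where
  "burau t w \<equiv> foldr (burau_letter t) w"

lemma burau_braid_eq:
  assumes "t \<noteq> 0"
  shows "braid_eq n v w \<Longrightarrow> burau t v f = burau t w f"
proof (induction arbitrary: f rule: braid_eq.induct)
  case (right_inverse i)
  show ?case using assms by (auto simp: fun_eq_iff field_simps)
next
  case (left_inverse i)
  show ?case using assms by (auto simp: fun_eq_iff field_simps)
next
  case (braid_relation i)
  show ?case by (auto simp: fun_eq_iff algebra_simps)
next
  case (far_commute i j)
  then show ?case by (auto simp: fun_eq_iff)
qed simp_all

lemma linear_op_burau: "linear_op (burau t w)"
proof (induction w)
  case (Cons l w)
  have "linear_op (burau_letter t l)"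
    by (cases l) (auto simp: linear_op_def fun_eq_iff algebra_simps add_divide_distrib)
  from linear_op_comp[OF this Cons] show ?case by (simp add: comp_def)
qed (simp add: linear_op_def)

text \<open>Both kinds of Burau letters have this shape: the new value at a position combines at most two old
values.\<close>

lemma matrix_on_local:
  assumes "\<And>f i. i \<in> {1..n} \<Longrightarrow> T f i = a i * f (p i) + b i * f (q i)"
    and "\<And>i. i \<in> {1..n} \<Longrightarrow> p i \<in> {1..n} \<and> q i \<in> {1..n}"
  shows "matrix_on n T"
  unfolding matrix_on_def
proof (intro allI ballI)
  fix f i assume i: "i \<in> {1..n}"
  have "(\<Sum>j\<in>{1..n}. f j * T (unit_fun j) i)
      = (\<Sum>j\<in>{1..n}. (a i * f j) * unit_fun j (p i)) + (\<Sum>j\<in>{1..n}. (b i * f j) * unit_fun j (q i))"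
    by (simp add: assms(1)[OF i] sum.distrib[symmetric] algebra_simps)
  also have "\<dots> = T f i"
    using assms(2)[OF i] by (subst (1 2) sum_unit_fun) (auto simp: assms(1)[OF i])
  finally show "T f i = (\<Sum>j\<in>{1..n}. f j * T (unit_fun j) i)" ..
qed

lemma matrix_on_burau: "braid_word n w \<Longrightarrow> matrix_on n (burau t w)"
proof (induction w)
  case Nil
  show ?case by (simp add: matrix_on_def sum_unit_fun)
next
  case (Cons l w)
  then have l: "1 \<le> letter_index l" "letter_index l < n" and w: "braid_word n w"
    by (simp_all add: braid_word_Cons)
  have "matrix_on n (burau_letter t l)"
  proof (cases l)
    case (Sigma k)
    show ?thesis
      by (rule matrix_on_local[where p = "\<lambda>i. if i = Suc k then k else i" and q = "\<lambda>i. if i = k then Suc k else i"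
            and a = "\<lambda>i. if i = k then 1 - t else 1" and b = "\<lambda>i. if i = k then t else 0"])
        (use Sigma l in auto)
  next
    case (Sigma_inv k)
    show ?thesis
      by (rule matrix_on_local[where p = "\<lambda>i. if i = Suc k then k else i" and q = "\<lambda>i. if i = k then Suc k else i"
            and a = "\<lambda>i. if i = k then 0 else if i = Suc k then 1 / t else 1"
            and b = "\<lambda>i. if i = k then 1 else if i = Suc k then 1 - 1 / t else 0"])
        (use Sigma_inv l in auto)
  qed
  from matrix_on_comp[OF this Cons.IH[OF w]] show ?case by (simp add: comp_def)
qed

lemma burau_const: "burau t w (\<lambda>_. c) = (\<lambda>_. c)"
proof (induction w)
  case (Cons l w)
  then show ?case by (cases l) (auto simp: fun_eq_iff algebra_simps add_divide_distrib[symmetric])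
qed simp

lemma burau_weighted_sum:
  assumes "t \<noteq> 0"
  shows "braid_word n w \<Longrightarrow> (\<Sum>i\<in>{1..n}. t ^ i * burau t w f i) = (\<Sum>i\<in>{1..n}. t ^ i * f i)"
proof (induction w)
  case (Cons l w)
  define k where "k = letter_index l"
  have k: "1 \<le> k" "k < n" and w: "braid_word n w"
    using Cons.prems by (simp_all add: braid_word_Cons k_def)
  have "(\<Sum>i\<in>{1..n}. t ^ i * (burau_letter t l g i - g i)) = 0" for g
  proof -
    have "burau_letter t l g i = g i" if "i \<noteq> k" "i \<noteq> Suc k" for i
      using that by (cases l) (auto simp: k_def)
    then have "(\<Sum>i\<in>{1..n}. t ^ i * (burau_letter t l g i - g i))
        = (\<Sum>i\<in>{k, Suc k}. t ^ i * (burau_letter t l g i - g i))"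
      using k by (intro sum.mono_neutral_right) auto
    also have "\<dots> = 0"
      using assms by (cases l) (auto simp: k_def field_simps)
    finally show ?thesis .
  qed
  then have "(\<Sum>i\<in>{1..n}. t ^ i * burau_letter t l g i) = (\<Sum>i\<in>{1..n}. t ^ i * g i)" for g
    by (simp add: right_diff_distrib sum_subtractf)
  then show ?case using Cons.IH[OF w] by simp
qed simp

lemma burau_above:
  "braid_word n w \<Longrightarrow> n < i \<Longrightarrow> burau t w f i = f i"
proof (induction w)
  case (Cons l w)
  then show ?case by (cases l) (auto simp: braid_word_Cons)
qed simp

lemma burau_unit_above:
  "braid_word n w \<Longrightarrow> n < i \<Longrightarrow> burau t w (unit_fun i) = unit_fun i"
proof (induction w)
  case (Cons l w)
  then show ?case by (cases l) (auto simp: braid_word_Cons unit_fun_def fun_eq_iff)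
qed simp

text \<open>The exponent makes the two stabilisations agree: a negative one divides the minor by \<open>t = s\<^sup>2\<close> and
raises the exponent by two.\<close>

definition conway_value :: "real \<Rightarrow> nat \<times> letter list \<Rightarrow> real" where
  "conway_value s = (\<lambda>(n, w).
     s powi (int n - 1 - exponent_sum w) * absorbed_det n (burau (s\<^sup>2) w))"

lemma absorbed_det_burau_stabilise:
  assumes w: "braid_word n w" and t: "t \<noteq> 0"
  shows "absorbed_det (Suc n) (burau t (w @ [Sigma n])) = absorbed_det n (burau t w)"
    and "absorbed_det (Suc n) (burau t (w @ [Sigma_inv n])) = absorbed_det n (burau t w) / t"
proof -
  have n: "0 < n" using w by (simp add: braid_word_def)
  note st = absorbed_det_stabilise[OF linear_op_burau burau_unit_above[OF w lessI] burau_above[OF w lessI] _ _ _ _ _ n]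
  have "absorbed_det (Suc n) (\<lambda>f. burau t w (burau_letter t (Sigma n) f)) = (1 - 0) * absorbed_det n (burau t w)"
    by (rule st[where a = "1 - t" and b = 1 and c = t])
      (auto simp: unit_fun_def fun_eq_iff)
  then show "absorbed_det (Suc n) (burau t (w @ [Sigma n])) = absorbed_det n (burau t w)"
    by (simp add: absorbed_det_def)
  have "absorbed_det (Suc n) (\<lambda>f. burau t w (burau_letter t (Sigma_inv n) f))
      = (1 - (1 - 1 / t)) * absorbed_det n (burau t w)"
    by (rule st[where a = 0 and b = "1 / t" and c = 1])
      (use t in \<open>auto simp: unit_fun_def fun_eq_iff\<close>)
  then show "absorbed_det (Suc n) (burau t (w @ [Sigma_inv n])) = absorbed_det n (burau t w) / t"
    by (simp add: absorbed_det_def)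
qed

lemma conway_value_markov:
  assumes s: "s \<noteq> 0"
  shows "markov_eq a b \<Longrightarrow> conway_value s a = conway_value s b"
proof (induction rule: markov_eq.induct)
  case (braid n v w)
  have "burau (s\<^sup>2) v = burau (s\<^sup>2) w"
    using burau_braid_eq[OF _ braid] s by (simp add: fun_eq_iff)
  then show ?case by (simp add: conway_value_def braid_eq_exponent_sum[OF braid])
next
  case (conjugation n u v)
  then have u: "braid_word n u" and v: "braid_word n v" and n: "0 < n" by (auto simp: braid_word_def)
  have t: "s\<^sup>2 \<noteq> 0" using s by simp
  have "absorbed_det n (\<lambda>f. burau (s\<^sup>2) u (burau (s\<^sup>2) v f))
      = absorbed_det n (\<lambda>f. burau (s\<^sup>2) v (burau (s\<^sup>2) u f))"
    by (rule absorbed_det_commute[OF matrix_on_burau[OF u] matrix_on_burau[OF v] n t burau_const burau_const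
          burau_weighted_sum[OF t u] burau_weighted_sum[OF t v]])
  then show ?case by (simp add: conway_value_def absorbed_det_def add.commute)
next
  case (pos_stabilisation n w)
  then show ?case using s
    by (simp add: conway_value_def absorbed_det_burau_stabilise algebra_simps del: foldr_append)
next
  case (neg_stabilisation n w)
  have "s powi (int n + 1 - exponent_sum w) = s powi (int n - 1 - exponent_sum w) * s\<^sup>2"
    using power_int_add[of s "int n - 1 - exponent_sum w" 2] s by (simp add: algebra_simps)
  then show ?case using s neg_stabilisation
    by (simp add: conway_value_def absorbed_det_burau_stabilise algebra_simps del: foldr_append)
qed auto

text \<open>The operators of \<open>\<sigma>\<^sub>i\<close>, \<open>\<sigma>\<^sub>i\<^sup>-\<^sup>1\<close> and the empty word lie on one line \<open>1 + c R\<close> with \<open>R\<close> of rank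
one, at \<open>c = 1\<close>, \<open>c = 1 / t\<close> and \<open>c = 0\<close>. So the three minors are values of one affine function
of \<open>c\<close>, which is a linear relation between them.\<close>

lemma conway_value_skein:
  assumes s: "s \<noteq> 0"
  shows "conway_value s (n, u @ [Sigma i] @ v) - conway_value s (n, u @ [Sigma_inv i] @ v)
    = (1 / s - s) * conway_value s (n, u @ v)"
proof -
  define t where "t = s\<^sup>2"
  have t: "t \<noteq> 0" using s by (simp add: t_def)
  \<comment> \<open>The column factor of the rank-one operator; its row factor is \<open>g i - g (i + 1)\<close>.\<close>
  define \<rho> where "\<rho> = (\<lambda>p. - t * unit_fun i p + 1 * unit_fun (Suc i) p)"
  obtain W where W: "\<And>c. absorbed_det n (\<lambda>f p. burau t (u @ v) f p
      + c * (burau t v f i - burau t v f (Suc i)) * burau t u \<rho> p)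
      = absorbed_det n (burau t (u @ v)) + c * W"
    using absorbed_det_rank_one[of n "burau t (u @ v)" "\<lambda>f. burau t v f i - burau t v f (Suc i)" "burau t u \<rho>"]
    by blast
  have letter: "burau t u (\<lambda>p. g p + c * (g i - g (Suc i)) * \<rho> p)
      = (\<lambda>p. burau t u g p + c * (g i - g (Suc i)) * burau t u \<rho> p)" for c g
    using linear_opD[OF linear_op_burau, of t u 1 g "c * (g i - g (Suc i))" \<rho>] by simp
  have pos: "burau_letter t (Sigma i) g = (\<lambda>p. g p + 1 * (g i - g (Suc i)) * \<rho> p)" for g
    by (auto simp: \<rho>_def unit_fun_def fun_eq_iff algebra_simps)
  have neg: "burau_letter t (Sigma_inv i) g = (\<lambda>p. g p + (1 / t) * (g i - g (Suc i)) * \<rho> p)" for g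
    using t by (auto simp: \<rho>_def unit_fun_def fun_eq_iff field_simps)
  have P: "absorbed_det n (burau t (u @ [Sigma i] @ v)) = absorbed_det n (burau t (u @ v)) + 1 * W"
    unfolding W[symmetric]
    by (rule arg_cong[of _ _ "absorbed_det n"]) (simp only: foldr_append foldr.simps comp_def id_def pos letter fun_eq_iff, simp)
  have N: "absorbed_det n (burau t (u @ [Sigma_inv i] @ v)) = absorbed_det n (burau t (u @ v)) + (1 / t) * W"
    unfolding W[symmetric]
    by (rule arg_cong[of _ _ "absorbed_det n"]) (simp only: foldr_append foldr.simps comp_def id_def neg letter fun_eq_iff, simp)
  define e where "e = int n - 1 - exponent_sum (u @ v)"
  have p: "s powi (e - 1) = s powi e / s" "s powi (e + 1) = s powi e * s"
    using s by (simp_all add: power_int_diff power_int_add)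
  have "conway_value s (n, u @ [Sigma i] @ v) = s powi (e - 1) * (absorbed_det n (burau t (u @ v)) + W)"
    using P by (simp add: conway_value_def t_def e_def algebra_simps)
  moreover have "conway_value s (n, u @ [Sigma_inv i] @ v)
      = s powi (e + 1) * (absorbed_det n (burau t (u @ v)) + (1 / t) * W)"
    using N by (simp add: conway_value_def t_def e_def algebra_simps)
  moreover have "conway_value s (n, u @ v) = s powi e * absorbed_det n (burau t (u @ v))"
    by (simp add: conway_value_def t_def e_def)
  moreover have "E / s * (D + W) - E * s * (D + 1 / t * W) = (1 / s - s) * (E * D)" for E D
    using s by (simp add: t_def field_simps power2_eq_square)
  ultimately show ?thesis by (simp only: p)
qed

lemma conway_value_unknot: "conway_value s (1, []) = 1"
  by (simp add: conway_value_def absorbed_det_def)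

section \<open>Computing with the skein relation\<close>

text \<open>The computations that the skein relation permits. A split strand gives zero because the two
stabilisations of a word have the same value, so that the skein relation yields \<open>z\<close> times the value
of the split closure as zero.\<close>

inductive skein_value :: "nat \<times> letter list \<Rightarrow> int poly \<Rightarrow> bool" where
  unknot: "skein_value (1, []) 1"
| split: "braid_word n w \<Longrightarrow> skein_value (Suc n, w) 0"
| markov: "skein_value a p \<Longrightarrow> markov_eq a b \<Longrightarrow> skein_value b p"
| pos: "braid_word n (u @ [Sigma i] @ v) \<Longrightarrow> skein_value (n, u @ [Sigma_inv i] @ v) p \<Longrightarrow>
    skein_value (n, u @ v) q \<Longrightarrow> skein_value (n, u @ [Sigma i] @ v) (p + [:0, 1:] * q)"
| neg: "braid_word n (u @ [Sigma i] @ v) \<Longrightarrow> skein_value (n, u @ [Sigma i] @ v) p \<Longrightarrow>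
    skein_value (n, u @ v) q \<Longrightarrow> skein_value (n, u @ [Sigma_inv i] @ v) (p - [:0, 1:] * q)"

text \<open>Skein invariants with values in an arbitrary domain: the same computation is used for integer
polynomials, where \<open>z\<close> is the variable, and for real values of \<open>z\<close>.\<close>

definition conway_like :: "'a :: idom \<Rightarrow> (nat \<times> letter list \<Rightarrow> 'a) \<Rightarrow> bool" where
  "conway_like z \<Phi> \<longleftrightarrow> \<Phi> (1, []) = 1 \<and> (\<forall>a b. markov_eq a b \<longrightarrow> \<Phi> a = \<Phi> b) \<and>
     (\<forall>n u v i. braid_word n (u @ [Sigma i] @ v) \<longrightarrow>
        \<Phi> (n, u @ [Sigma i] @ v) - \<Phi> (n, u @ [Sigma_inv i] @ v) = z * \<Phi> (n, u @ v))"

lemma conway_like_markov: "conway_like z \<Phi> \<Longrightarrow> markov_eq a b \<Longrightarrow> \<Phi> a = \<Phi> b"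
  unfolding conway_like_def by blast

lemma conway_like_skein:
  "conway_like z \<Phi> \<Longrightarrow> braid_word n (u @ [Sigma i] @ v) \<Longrightarrow>
    \<Phi> (n, u @ [Sigma i] @ v) - \<Phi> (n, u @ [Sigma_inv i] @ v) = z * \<Phi> (n, u @ v)"
  unfolding conway_like_def by blast

lemma conway_like_skein_value:
  fixes h :: "int poly \<Rightarrow> 'a :: idom"
  assumes hom: "h 1 = 1" "\<And>p q. h (p + q) = h p + h q" "\<And>p q. h (p * q) = h p * h q"
    and z: "h [:0, 1:] \<noteq> 0" and \<Phi>: "conway_like (h [:0, 1:]) \<Phi>"
  shows "skein_value a p \<Longrightarrow> \<Phi> a = h p"
proof (induction rule: skein_value.induct)
  case unknot
  then show ?case using \<Phi> hom(1) by (simp add: conway_like_def)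
next
  case (split n w)
  have w: "braid_word (Suc n) (w @ [Sigma n] @ [])"
    using split by (auto simp: braid_word_def)
  have "\<Phi> (Suc n, w @ [Sigma n] @ []) - \<Phi> (Suc n, w @ [Sigma_inv n] @ []) = h [:0, 1:] * \<Phi> (Suc n, w @ [])"
    by (rule conway_like_skein[OF \<Phi> w])
  moreover have "\<Phi> (Suc n, w @ [Sigma n] @ []) = \<Phi> (n, w)" "\<Phi> (Suc n, w @ [Sigma_inv n] @ []) = \<Phi> (n, w)"
    using conway_like_markov[OF \<Phi> markov_eq.pos_stabilisation[OF split]]
      conway_like_markov[OF \<Phi> markov_eq.neg_stabilisation[OF split]] by simp_all
  moreover have "h 0 = 0" using hom(2)[of 0 0] by (metis add_0 add_cancel_right_right)
  ultimately show ?case using z by simp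
next
  case (markov a p b)
  then show ?case using conway_like_markov[OF \<Phi>] by metis
next
  case (pos n u i v p q)
  then have "\<Phi> (n, u @ [Sigma i] @ v) - \<Phi> (n, u @ [Sigma_inv i] @ v) = h [:0, 1:] * \<Phi> (n, u @ v)"
    using conway_like_skein[OF \<Phi>] by blast
  then show ?case using pos.IH unfolding hom(2) hom(3) by (simp add: algebra_simps)
next
  case (neg n u i v p q)
  then have "\<Phi> (n, u @ [Sigma i] @ v) - \<Phi> (n, u @ [Sigma_inv i] @ v) = h [:0, 1:] * \<Phi> (n, u @ v)"
    using conway_like_skein[OF \<Phi>] by blast
  moreover have diff: "h (p - r) = h p - h r" for r
    using hom(2)[of "p - r" r] by simp
  ultimately show ?case using neg.IH unfolding diff hom(3) by (simp add: algebra_simps)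
qed

definition skein_computable :: "nat \<Rightarrow> letter list \<Rightarrow> bool" where
  "skein_computable n w \<longleftrightarrow> (\<exists>p. skein_value (n, w) p)"

lemma skein_computable_markov: "skein_computable m v \<Longrightarrow> markov_eq (m, v) (n, w) \<Longrightarrow> skein_computable n w"
  unfolding skein_computable_def using skein_value.markov by blast

lemma skein_computable_flip:
  assumes "braid_word n (u @ [l] @ v)" "letter_index l = letter_index l'"
    and "skein_computable n (u @ v)" "skein_computable n (u @ [l'] @ v)"
  shows "skein_computable n (u @ [l] @ v)"
proof -
  define i where "i = letter_index l"
  have w: "braid_word n (u @ [Sigma i] @ v)"
    using assms(1) by (simp add: braid_word_Cons i_def)
  have "(l = Sigma i \<or> l = Sigma_inv i) \<and> (l' = Sigma i \<or> l' = Sigma_inv i)"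
    using assms(2) unfolding i_def by (cases l; cases l') auto
  then show ?thesis
    using assms(3,4) skein_value.pos[OF w] skein_value.neg[OF w] unfolding skein_computable_def by blast
qed

text \<open>To compute \<open>a @ x @ b\<close> it suffices to compute \<open>a @ y @ b\<close>, provided that all shorter words have been
computed. Quantifying over the context makes this a congruence.\<close>

definition reduces :: "nat \<Rightarrow> letter list \<Rightarrow> letter list \<Rightarrow> bool" where
  "reduces n x y \<longleftrightarrow> braid_word n x \<and> braid_word n y \<and> length y \<le> length x \<and>
     (\<forall>a b. braid_word n a \<longrightarrow> braid_word n b \<longrightarrow>
        (\<forall>w. braid_word n w \<longrightarrow> length w < length (a @ x @ b) \<longrightarrow> skein_computable n w) \<longrightarrow>
        skein_computable n (a @ y @ b) \<longrightarrow> skein_computable n (a @ x @ b))"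

lemma reduces_refl: "braid_word n x \<Longrightarrow> reduces n x x"
  by (auto simp: reduces_def)

lemma reduces_trans [trans]:
  assumes "reduces n x y" "reduces n y z"
  shows "reduces n x z"
  unfolding reduces_def
proof (intro conjI allI impI)
  fix a b
  assume ab: "braid_word n a" "braid_word n b"
    and sh: "\<forall>w. braid_word n w \<longrightarrow> length w < length (a @ x @ b) \<longrightarrow> skein_computable n w"
    and z: "skein_computable n (a @ z @ b)"
  have "\<forall>w. braid_word n w \<longrightarrow> length w < length (a @ y @ b) \<longrightarrow> skein_computable n w"
    using sh assms(1) by (simp add: reduces_def)
  with ab z assms(2) have "skein_computable n (a @ y @ b)" by (simp add: reduces_def)
  with ab sh assms(1) show "skein_computable n (a @ x @ b)" by (simp add: reduces_def)
qed (use assms in \<open>auto simp: reduces_def\<close>)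

lemma reduces_context:
  assumes "reduces n x y" and "braid_word n a" "braid_word n b"
  shows "reduces n (a @ x @ b) (a @ y @ b)"
  unfolding reduces_def
proof (intro conjI allI impI)
  fix c d
  assume "braid_word n c" "braid_word n d"
    and "\<forall>w. braid_word n w \<longrightarrow> length w < length (c @ (a @ x @ b) @ d) \<longrightarrow> skein_computable n w"
    and "skein_computable n (c @ (a @ y @ b) @ d)"
  then show "skein_computable n (c @ (a @ x @ b) @ d)"
    using assms unfolding reduces_def
    by (elim conjE) (drule spec[of _ "c @ a"], drule spec[of _ "b @ d"], simp)
qed (use assms in \<open>auto simp: reduces_def\<close>)

lemma reduces_braid_eq:
  assumes "braid_eq n x y" "length y \<le> length x"
  shows "reduces n x y"
  unfolding reduces_def
proof (intro conjI allI impI)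
  fix a b
  assume "braid_word n a" "braid_word n b" "skein_computable n (a @ y @ b)"
  moreover from this have "braid_eq n (a @ y @ b) (a @ x @ b)"
    using assms(1) by (intro braid_eq.mult braid_eq.refl braid_eq.sym[of n x y])
  ultimately show "skein_computable n (a @ x @ b)"
    by (blast intro: skein_computable_markov markov_eq.braid)
qed (use assms braid_eq_imp_braid_word in auto)

text \<open>The two words differ by the skein relation, and the third word in it is shorter.\<close>

lemma reduces_flip:
  assumes "letter_index l = letter_index l'" "braid_word n [l]"
  shows "reduces n [l] [l']"
  unfolding reduces_def
  using assms by (auto simp: braid_word_Cons intro: skein_computable_flip[where l' = l', simplified])

definition letters_below :: "nat \<Rightarrow> letter list \<Rightarrow> bool" where
  "letters_below m w \<longleftrightarrow> (\<forall>l\<in>set w. 1 \<le> letter_index l \<and> letter_index l < m)"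

lemma letters_below_braid_word: "letters_below m w \<Longrightarrow> m \<le> n \<Longrightarrow> 1 \<le> n \<Longrightarrow> braid_word n w"
  by (force simp: letters_below_def braid_word_def)

lemma letters_below_simps [simp]:
  "letters_below m []" "letters_below m (u @ v) \<longleftrightarrow> letters_below m u \<and> letters_below m v"
  "letters_below m (l # w) \<longleftrightarrow> 1 \<le> letter_index l \<and> letter_index l < m \<and> letters_below m w"
  by (auto simp: letters_below_def)

lemma letters_below_mono: "letters_below m w \<Longrightarrow> m \<le> k \<Longrightarrow> letters_below k w"
  by (force simp: letters_below_def)

lemma braid_eq_context:
  assumes "braid_eq n x y" "braid_word n a" "braid_word n b"
  shows "braid_eq n (a @ x @ b) (a @ y @ b)"
  by (intro braid_eq.mult braid_eq.refl assms)

text \<open>For an inverse letter, insert \<open>\<sigma>\<^sub>i\<^sup>-\<^sup>1 \<sigma>\<^sub>i\<close> on the left and commute the positive letter.\<close>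

lemma braid_eq_commute_letter:
  assumes l: "1 \<le> letter_index l" "letter_index l + 2 \<le> m" and m: "m < n"
  shows "braid_eq n [Sigma m, l] [l, Sigma m]"
proof (cases l)
  case (Sigma i)
  then show ?thesis
    using l m by (auto intro!: braid_eq.sym[OF braid_eq.far_commute] simp: braid_word_Cons)
next
  case (Sigma_inv i)
  then have i: "1 \<le> i" "i + 2 \<le> m" using l by auto
  have bw: "braid_word n [Sigma m]" "braid_word n [Sigma i]" "braid_word n [Sigma_inv i]" "braid_word n []"
    using i m by (auto simp: braid_word_Cons)
  have "braid_eq n ([] @ [Sigma_inv i, Sigma i] @ [Sigma m, Sigma_inv i]) ([] @ [] @ [Sigma m, Sigma_inv i])"
    by (rule braid_eq_context[OF braid_eq.left_inverse]) (use bw in \<open>auto simp: braid_word_Cons\<close>)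
  then have "braid_eq n [Sigma m, Sigma_inv i] [Sigma_inv i, Sigma i, Sigma m, Sigma_inv i]"
    by (auto intro: braid_eq.sym)
  moreover have "braid_eq n ([Sigma_inv i] @ [Sigma i, Sigma m] @ [Sigma_inv i])
      ([Sigma_inv i] @ [Sigma m, Sigma i] @ [Sigma_inv i])"
    by (rule braid_eq_context[OF braid_eq.far_commute]) (use bw i in \<open>auto simp: braid_word_Cons\<close>)
  moreover have "braid_eq n ([Sigma_inv i, Sigma m] @ [Sigma i, Sigma_inv i] @ []) ([Sigma_inv i, Sigma m] @ [] @ [])"
    by (rule braid_eq_context[OF braid_eq.right_inverse]) (use bw in \<open>auto simp: braid_word_Cons\<close>)
  ultimately have "braid_eq n [Sigma m, Sigma_inv i] [Sigma_inv i, Sigma m]"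
    by (auto intro: braid_eq.trans)
  then show ?thesis using Sigma_inv by simp
qed

lemma braid_eq_commute_word:
  assumes m: "1 \<le> m" "m < n"
  shows "letters_below (m - 1) w \<Longrightarrow> braid_eq n ([Sigma m] @ w) (w @ [Sigma m])"
proof (induction w)
  case Nil
  show ?case using m by (auto intro!: braid_eq.refl simp: braid_word_Cons)
next
  case (Cons l w)
  then have l: "1 \<le> letter_index l" "letter_index l + 2 \<le> m" and w: "letters_below (m - 1) w"
    by auto
  have bw: "braid_word n w" "braid_word n [l]"
    using letters_below_braid_word[OF w, of n] m l by (auto simp: braid_word_Cons)
  have "braid_eq n ([] @ [Sigma m, l] @ w) ([] @ [l, Sigma m] @ w)"
    by (rule braid_eq_context[OF braid_eq_commute_letter[OF l m(2)]]) (use bw m in auto)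
  moreover have "braid_eq n ([l] @ ([Sigma m] @ w)) ([l] @ (w @ [Sigma m]))"
    by (rule braid_eq.mult[OF braid_eq.refl[OF bw(2)] Cons.IH[OF w]])
  ultimately show ?case by (auto intro: braid_eq.trans)
qed

text \<open>Between two letters of index \<open>m\<close> there is, by induction on \<open>m\<close>, at most one letter of index
\<open>m - 1\<close>. If there is none, the two letters meet and one of them can be inverted to cancel. If there is
one, the braid relation \<open>\<sigma>\<^sub>m \<sigma>\<^sub>m\<^sub>-\<^sub>1 \<sigma>\<^sub>m = \<sigma>\<^sub>m\<^sub>-\<^sub>1 \<sigma>\<^sub>m \<sigma>\<^sub>m\<^sub>-\<^sub>1\<close> removes one of them. In
the induction step \<open>k\<close> stands for \<open>m - 1\<close>; \<open>m = 0\<close> is admitted, and then there are no letters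
at all.\<close>

lemma reduces_to_one_top_letter:
  "m < n \<Longrightarrow> letters_below (Suc m) x \<Longrightarrow>
    \<exists>y. reduces n x y \<and> (letters_below m y \<or>
      (\<exists>a b. y = a @ [Sigma m] @ b \<and> letters_below m a \<and> letters_below m b))"
proof (induction m arbitrary: x)
  case 0
  then have "x = []" by (cases x) auto
  then show ?case using 0 by (auto intro!: exI[of _ "[]"] reduces_refl)
next
  case (Suc k)
  define m where "m = Suc k"
  have m: "1 \<le> m" "m < n" "k < n" using Suc.prems by (auto simp: m_def)
  have bw: "braid_word n w" if "letters_below m w" for w
    by (rule letters_below_braid_word[OF that]) (use m in auto)
  have bm: "braid_word n [Sigma m]" "braid_word n []" using m by (auto simp: braid_word_Cons)
  have inner: "\<exists>y. reduces n ([Sigma m] @ a @ [Sigma m] @ b) y \<and> (letters_below m y \<or>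
      (\<exists>a b. y = a @ [Sigma m] @ b \<and> letters_below m a \<and> letters_below m b))"
    if a: "letters_below m a" and b: "letters_below m b" for a b
  proof -
    obtain a1 where a1: "reduces n a a1" and alt: "letters_below k a1 \<or>
        (\<exists>c d. a1 = c @ [Sigma k] @ d \<and> letters_below k c \<and> letters_below k d)"
      using Suc.IH[OF m(3), of a] a unfolding m_def by blast
    have 1: "reduces n ([Sigma m] @ a @ [Sigma m] @ b) ([Sigma m] @ a1 @ [Sigma m] @ b)"
      by (rule reduces_context[OF a1]) (use bm bw[OF b] in \<open>auto simp: braid_word_Cons\<close>)
    from alt show ?thesis
    proof (elim disjE exE conjE)
      assume low: "letters_below k a1"
      have com: "braid_eq n ([Sigma m] @ a1) (a1 @ [Sigma m])"
        by (rule braid_eq_commute_word[OF m(1,2)]) (use low in \<open>simp add: m_def\<close>)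
      have below: "letters_below m a1" using low by (rule letters_below_mono) (simp add: m_def)
      note 1
      also have "reduces n ([] @ ([Sigma m] @ a1) @ ([Sigma m] @ b)) ([] @ (a1 @ [Sigma m]) @ ([Sigma m] @ b))"
        by (rule reduces_context[OF reduces_braid_eq[OF com]]) (use bm bw[OF b] in \<open>auto simp: braid_word_Cons\<close>)
      then have "reduces n ([Sigma m] @ a1 @ [Sigma m] @ b) (a1 @ [Sigma m] @ [Sigma m] @ b)" by simp
      also have "reduces n ((a1 @ [Sigma m]) @ [Sigma m] @ b) ((a1 @ [Sigma m]) @ [Sigma_inv m] @ b)"
        by (rule reduces_context[OF reduces_flip]) (use bm bw[OF b] bw[OF below] in auto)
      then have "reduces n (a1 @ [Sigma m] @ [Sigma m] @ b) (a1 @ [Sigma m, Sigma_inv m] @ b)" by simp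
      also have "reduces n (a1 @ [Sigma m, Sigma_inv m] @ b) (a1 @ [] @ b)"
        by (rule reduces_context[OF reduces_braid_eq[OF braid_eq.right_inverse]])
          (use bm bw[OF b] bw[OF below] in auto)
      finally have "reduces n ([Sigma m] @ a @ [Sigma m] @ b) (a1 @ b)" by simp
      moreover have "letters_below m (a1 @ b)" using below b by simp
      ultimately show ?thesis by blast
    next
      fix c d
      assume a1_eq: "a1 = c @ [Sigma k] @ d" and c: "letters_below k c" and d: "letters_below k d"
      have k: "1 \<le> k" using a1 by (auto simp: a1_eq reduces_def braid_word_Cons)
      have com: "braid_eq n ([Sigma m] @ c) (c @ [Sigma m])" "braid_eq n (d @ [Sigma m]) ([Sigma m] @ d)"
        using braid_eq_commute_word[OF m(1,2), of c] braid_eq_commute_word[OF m(1,2), of d, THEN braid_eq.sym] c d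
        by (simp_all add: m_def)
      have below: "letters_below m c" "letters_below m d"
        using c d by (auto intro: letters_below_mono simp: m_def)
      note bww = bw[OF below(1)] bw[OF below(2)] bw[OF b]
      have bk: "braid_word n [Sigma k]" using k m by (simp add: braid_word_Cons)
      note 1
      also have "reduces n ([] @ ([Sigma m] @ c) @ ([Sigma k] @ d @ [Sigma m] @ b))
          ([] @ (c @ [Sigma m]) @ ([Sigma k] @ d @ [Sigma m] @ b))"
        by (rule reduces_context[OF reduces_braid_eq[OF com(1)]]) (use bm bk bww in \<open>auto simp: braid_word_Cons\<close>)
      then have "reduces n ([Sigma m] @ a1 @ [Sigma m] @ b) (c @ [Sigma m] @ [Sigma k] @ d @ [Sigma m] @ b)"
        by (simp add: a1_eq)
      also have "reduces n ((c @ [Sigma m] @ [Sigma k]) @ (d @ [Sigma m]) @ b)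
          ((c @ [Sigma m] @ [Sigma k]) @ ([Sigma m] @ d) @ b)"
        by (rule reduces_context[OF reduces_braid_eq[OF com(2)]]) (use bm bk bww in \<open>auto simp: braid_word_Cons\<close>)
      then have "reduces n (c @ [Sigma m] @ [Sigma k] @ d @ [Sigma m] @ b)
          (c @ [Sigma m, Sigma k, Sigma m] @ d @ b)" by simp
      also have "reduces n (c @ [Sigma m, Sigma k, Sigma m] @ (d @ b)) (c @ [Sigma k, Sigma m, Sigma k] @ (d @ b))"
        by (rule reduces_context[OF reduces_braid_eq[OF braid_eq.sym[OF braid_eq.braid_relation[of n k, folded Suc_eq_plus1 m_def]]]])
          (use bm bk bww in \<open>auto simp: braid_word_Cons\<close>)
      finally have "reduces n ([Sigma m] @ a @ [Sigma m] @ b) ((c @ [Sigma k]) @ [Sigma m] @ ([Sigma k] @ d @ b))" by simp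
      moreover have "letters_below m (c @ [Sigma k])" "letters_below m ([Sigma k] @ d @ b)"
        using below b k by (auto simp: m_def)
      ultimately show ?thesis by blast
    qed
  qed
  show ?case using Suc.prems(2) unfolding m_def[symmetric]
  proof (induction x)
    case Nil
    show ?case using m by (auto intro!: exI[of _ "[]"] reduces_refl)
  next
    case (Cons l x)
    then have l: "1 \<le> letter_index l" "letter_index l \<le> m" and x: "letters_below (Suc m) x" by auto
    from Cons.IH[OF x] obtain y where y: "reduces n x y" and alt: "letters_below m y \<or>
        (\<exists>a b. y = a @ [Sigma m] @ b \<and> letters_below m a \<and> letters_below m b)" by blast
    have bl: "braid_word n [l]" using l m by (auto simp: braid_word_Cons)
    have 1: "reduces n ([l] @ x @ []) ([l] @ y @ [])"
      by (rule reduces_context[OF y bl]) (use bm in auto)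
    show ?case
    proof (cases "letter_index l = m")
      case False
      with l have lm: "letters_below m [l]" by simp
      from alt show ?thesis
      proof (elim disjE exE conjE)
        assume "letters_below m y"
        then have "letters_below m (l # y)" using lm by simp
        then show ?thesis using 1 by auto
      next
        fix a b assume "y = a @ [Sigma m] @ b" "letters_below m a" "letters_below m b"
        then have "l # y = (l # a) @ [Sigma m] @ b" "letters_below m (l # a)" "letters_below m b"
          using lm by auto
        moreover have "reduces n (l # x) (l # y)" using 1 by simp
        ultimately show ?thesis by blast
      qed
    next
      case True
      have "braid_word n y" using y by (simp add: reduces_def)
      then have "reduces n ([] @ [l] @ y) ([] @ [Sigma m] @ y)"
        by (intro reduces_context[OF reduces_flip[OF _ bl]]) (use True bm in auto)
      with 1 have 2: "reduces n (l # x) ([Sigma m] @ y)" by (auto intro: reduces_trans)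
      from alt show ?thesis
      proof (elim disjE exE conjE)
        assume "letters_below m y"
        then show ?thesis using 2 by (intro exI[of _ "[Sigma m] @ y"] conjI disjI2 exI[of _ "[]"] exI[of _ y]) auto
      next
        fix a b assume "y = a @ [Sigma m] @ b" "letters_below m a" "letters_below m b"
        then show ?thesis using inner[of a b] 2 by (auto intro: reduces_trans)
      qed
    qed
  qed
qed

text \<open>Induction on the number of strands, and for each of them on the length of the word. A single letter of
the top index is brought to the end by conjugation and removed by destabilising.\<close>

theorem skein_computable_all: "braid_word n w \<Longrightarrow> skein_computable n w"
proof (induction n arbitrary: w)
  case 0
  then show ?case by (simp add: braid_word_def)
next
  case (Suc n)
  show ?case
  proof (cases "n = 0")
    case True
    then have "w = []" using Suc.prems by (cases w) (auto simp: braid_word_Cons)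
    then show ?thesis using True skein_value.unknot by (auto simp: skein_computable_def)
  next
    case False
    show ?thesis using Suc.prems
    proof (induction w rule: length_induct)
      case (1 w)
      have "letters_below (Suc n) w"
        using 1(2) by (auto simp: letters_below_def braid_word_def)
      from reduces_to_one_top_letter[OF lessI this] obtain y where y: "reduces (Suc n) w y"
        and alt: "letters_below n y \<or> (\<exists>a b. y = a @ [Sigma n] @ b \<and> letters_below n a \<and> letters_below n b)"
        by blast
      have low: "braid_word n v" if "letters_below n v" for v
        using letters_below_braid_word[OF that] False by simp
      have "skein_computable (Suc n) y"
        using alt
      proof (elim disjE exE conjE)
        assume "letters_below n y"
        then show ?thesis using skein_value.split[OF low] by (auto simp: skein_computable_def)
      next
        fix a b assume y_eq: "y = a @ [Sigma n] @ b" and ab: "letters_below n a" "letters_below n b"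
        have "braid_word n (b @ a)" using low[OF ab(1)] low[OF ab(2)] by simp
        from skein_computable_markov[OF Suc.IH[OF this] markov_eq.pos_stabilisation[OF this]]
        have "skein_computable (Suc n) (b @ (a @ [Sigma n]))" by simp
        moreover have "markov_eq (Suc n, b @ (a @ [Sigma n])) (Suc n, (a @ [Sigma n]) @ b)"
          by (rule markov_eq.conjugation) (use y in \<open>auto simp: reduces_def y_eq braid_word_Cons\<close>)
        ultimately show ?thesis using skein_computable_markov by (simp add: y_eq)
      qed
      moreover have "\<forall>v. braid_word (Suc n) v \<longrightarrow> length v < length ([] @ w @ []) \<longrightarrow> skein_computable (Suc n) v"
        using 1(1) by simp
      ultimately show ?case
        using y unfolding reduces_def by (elim conjE) (drule spec[of _ "[]"], drule spec[of _ "[]"], simp)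
    qed
  qed
qed

section \<open>Existence and uniqueness of the Conway polynomial\<close>

definition real_eval :: "real \<Rightarrow> int poly \<Rightarrow> real" where
  "real_eval x p = poly (map_poly of_int p) x"

lemma real_eval_hom:
  "real_eval x 1 = 1" "real_eval x (p + q) = real_eval x p + real_eval x q"
  "real_eval x (p * q) = real_eval x p * real_eval x q" "real_eval x [:0, 1:] = x"
  by (simp_all add: real_eval_def of_int_poly_hom.hom_add of_int_poly_hom.hom_mult)

lemma conway_like_conway_value:
  "s \<noteq> 0 \<Longrightarrow> conway_like (1 / s - s) (conway_value s)"
  using conway_value_unknot conway_value_markov conway_value_skein by (auto simp: conway_like_def)

lemma conway_value_skein_value:
  assumes "skein_value a p" "s \<noteq> 0" "1 / s \<noteq> s"
  shows "conway_value s a = real_eval (1 / s - s) p"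
  using conway_like_skein_value[of "real_eval (1 / s - s)", OF _ _ _ _ _ assms(1)]
    conway_like_conway_value[OF assms(2)] assms(3) by (simp add: real_eval_hom)

lemma infinite_skein_parameters: "infinite ((\<lambda>s. 1 / s - s) ` {0<..<1 :: real})"
proof -
  have "inj_on (\<lambda>s. 1 / s - s) {0<..<1 :: real}"
  proof (rule inj_onI)
    fix s r :: real
    assume "s \<in> {0<..<1}" "r \<in> {0<..<1}" and eq: "1 / s - s = 1 / r - r"
    then have "s > 0" "r > 0" by auto
    then have "(r - s) * (1 + s * r) = 0" using eq by (simp add: field_simps)
    moreover have "1 + s * r > 0" using \<open>s > 0\<close> \<open>r > 0\<close> by (simp add: add_pos_pos)
    ultimately show "s = r" by simp
  qed
  then show ?thesis by (simp add: finite_image_iff)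
qed

lemma real_eval_eqI:
  assumes "\<And>s. 0 < s \<Longrightarrow> s < 1 \<Longrightarrow> real_eval (1 / s - s) p = real_eval (1 / s - s) q"
  shows "p = q"
proof -
  have "(\<lambda>s. 1 / s - s) ` {0<..<1} \<subseteq> {x. poly (map_poly of_int p - map_poly of_int q) x = (0 :: real)}"
    using assms by (auto simp: real_eval_def)
  then have "map_poly of_int p - map_poly of_int q = (0 :: real poly)"
    using infinite_skein_parameters poly_roots_finite finite_subset by blast
  then show ?thesis by (simp add: of_int_poly_hom.eq_iff)
qed

lemma less_one_inverse: "0 < s \<Longrightarrow> s < 1 \<Longrightarrow> 1 / s \<noteq> (s :: real)"
  using less_divide_eq[of 1 1 s] by force

text \<open>All real skein invariants at \<open>z = 1 / s - s\<close> take the value \<open>p(z)\<close>, and one exists for each \<open>s\<close>.\<close>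

lemma skein_value_unique:
  assumes "skein_value a p" "skein_value a q"
  shows "p = q"
proof (rule real_eval_eqI)
  fix s :: real assume "0 < s" "s < 1"
  then show "real_eval (1 / s - s) p = real_eval (1 / s - s) q"
    using conway_value_skein_value[OF assms(1), of s] conway_value_skein_value[OF assms(2), of s]
      less_one_inverse[of s] by simp
qed

lemma markov_eq_braid_word:
  "markov_eq a b \<Longrightarrow> braid_word (fst a) (snd a) \<and> braid_word (fst b) (snd b)"
proof (induction rule: markov_eq.induct)
  case (braid n v w)
  then show ?case by (simp add: braid_eq_imp_braid_word)
qed (auto simp: braid_word_Cons braid_word_def)

lemma abs_link_eqI: "markov_eq a b \<Longrightarrow> abs_link a = abs_link b"
  using Quotient_rel[OF Quotient_link, of a b] by auto

lemma markov_eq_refl: "braid_word n w \<Longrightarrow> markov_eq (n, w) (n, w)"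
  by (intro markov_eq.braid braid_eq.refl)

lemma rep_abs_link: "braid_word n w \<Longrightarrow> markov_eq (rep_link (abs_link (n, w))) (n, w)"
  using Quotient_rep_abs[OF Quotient_link markov_eq_refl] by auto

lemma link_cases:
  obtains n w where "L = braid_closure n w" "braid_word n w"
proof -
  have "markov_eq (rep_link L) (rep_link L)"
    by (rule Quotient_rep_reflp[OF Quotient_link])
  then have "braid_word (fst (rep_link L)) (snd (rep_link L))"
    by (rule markov_eq_braid_word[THEN conjunct1])
  moreover have "L = braid_closure (fst (rep_link L)) (snd (rep_link L))"
    using Quotient_abs_rep[OF Quotient_link, of L] by (simp add: braid_closure_def)
  ultimately show ?thesis using that by blast
qed

lemma is_conway_skein_value:
  assumes "is_conway C" "skein_value (n, w) p"
  shows "C (braid_closure n w) = p"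
proof -
  have "conway_like [:0, 1:] (\<lambda>a. C (abs_link a))"
    using assms(1) unfolding conway_like_def is_conway_def unknot_def braid_closure_def
    by (auto dest: abs_link_eqI)
  from conway_like_skein_value[of "\<lambda>p. p", OF _ _ _ _ this assms(2)]
  show ?thesis by (simp add: braid_closure_def)
qed

text \<open>The skein relation holds by the rule of computation for positive crossings, since results of
computations are unique.\<close>

lemma ex_is_conway: "\<exists>C. is_conway C"
proof
  define C where "C L = (THE p. skein_value (rep_link L) p)" for L
  have C: "C (braid_closure n w) = p" if "skein_value (n, w) p" "braid_word n w" for n w p
  proof -
    have "skein_value (rep_link (abs_link (n, w))) p"
      using skein_value.markov[OF that(1)] rep_abs_link[OF that(2)] markov_eq.sym by blast
    then show ?thesis
      unfolding C_def braid_closure_def using skein_value_unique by blast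
  qed
  show "is_conway C"
    unfolding is_conway_def
  proof (intro conjI allI impI)
    show "C unknot = 1"
      unfolding unknot_def by (rule C[OF skein_value.unknot]) simp
  next
    fix n u v i
    assume bw: "braid_word n (u @ [Sigma i] @ v)"
    then have bw': "braid_word n (u @ [Sigma_inv i] @ v)" "braid_word n (u @ v)"
      by (auto simp: braid_word_Cons)
    obtain p q where pq: "skein_value (n, u @ [Sigma_inv i] @ v) p" "skein_value (n, u @ v) q"
      using skein_computable_all[OF bw'(1)] skein_computable_all[OF bw'(2)] by (auto simp: skein_computable_def)
    show "C (braid_closure n (u @ [Sigma i] @ v)) - C (braid_closure n (u @ [Sigma_inv i] @ v))
        = [:0, 1:] * C (braid_closure n (u @ v))"
      unfolding C[OF pq(1) bw'(1)] C[OF pq(2) bw'(2)] C[OF skein_value.pos[OF bw pq] bw] by simp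
  qed
qed

theorem is_conway_conway: "is_conway conway"
  unfolding conway_def
proof (rule theI'[of is_conway])
  show "\<exists>!C. is_conway C"
  proof (rule ex_ex1I[OF ex_is_conway])
    fix C D assume CD: "is_conway C" "is_conway D"
    show "C = D"
    proof
      fix L
      obtain n w where L: "L = braid_closure n w" "braid_word n w" by (rule link_cases)
      obtain p where "skein_value (n, w) p"
        using skein_computable_all[OF L(2)] by (auto simp: skein_computable_def)
      then show "C L = D L" using CD is_conway_skein_value L(1) by metis
    qed
  qed
qed

lemma skein_value_conway:
  assumes "braid_word n w"
  shows "skein_value (n, w) (conway (braid_closure n w))"
  using skein_computable_all[OF assms] is_conway_skein_value[OF is_conway_conway]
  by (auto simp: skein_computable_def)

lemma conway_value_eq:
  assumes "braid_word n w" "s \<noteq> 0" "1 / s \<noteq> s"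
  shows "conway_value s (n, w) = real_eval (1 / s - s) (conway (braid_closure n w))"
  by (rule conway_value_skein_value[OF skein_value_conway[OF assms(1)] assms(2,3)])

section \<open>Reversed words\<close>

lemma braid_word_rev [simp]: "braid_word n (rev w) \<longleftrightarrow> braid_word n w"
  by (simp add: braid_word_def)

lemma braid_eq_rev: "braid_eq n v w \<Longrightarrow> braid_eq n (rev v) (rev w)"
proof (induction rule: braid_eq.induct)
  case (far_commute i j)
  then show ?case using braid_eq.sym[OF braid_eq.far_commute[of n i j]] by simp
next
  case (braid_relation i)
  then show ?case using braid_eq.braid_relation[of n i] by simp
qed (auto intro: braid_eq.intros)

text \<open>Every relation is mapped to one of the same kind; only a stabilisation ends up at the wrong end of the
word, which a conjugation repairs.\<close>

lemma markov_eq_rev: "markov_eq a b \<Longrightarrow> markov_eq (map_prod id rev a) (map_prod id rev b)"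
proof (induction rule: markov_eq.induct)
  case (braid n v w)
  then show ?case by (simp add: markov_eq.braid braid_eq_rev)
next
  case (conjugation n u v)
  then show ?case using markov_eq.conjugation[of n "rev v" "rev u"] by simp
next
  case (pos_stabilisation n w)
  then have "markov_eq (n + 1, rev w @ [Sigma n]) (n + 1, [Sigma n] @ rev w)"
    by (intro markov_eq.conjugation) (auto simp: braid_word_def)
  with markov_eq.pos_stabilisation[of n "rev w"] pos_stabilisation show ?case
    by (auto intro: markov_eq.trans)
next
  case (neg_stabilisation n w)
  then have "markov_eq (n + 1, rev w @ [Sigma_inv n]) (n + 1, [Sigma_inv n] @ rev w)"
    by (intro markov_eq.conjugation) (auto simp: braid_word_def)
  with markov_eq.neg_stabilisation[of n "rev w"] neg_stabilisation show ?case
    by (auto intro: markov_eq.trans)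
qed (auto intro: markov_eq.sym markov_eq.trans)

lemma skein_value_rev: "skein_value a p \<Longrightarrow> skein_value (map_prod id rev a) p"
proof (induction rule: skein_value.induct)
  case unknot
  show ?case using skein_value.unknot by simp
next
  case (split n w)
  then show ?case by (simp add: skein_value.split)
next
  case (markov a p b)
  then show ?case using skein_value.markov markov_eq_rev by blast
next
  case (pos n u i v p q)
  then show ?case using skein_value.pos[of n "rev v" i "rev u" p q] by (simp add: braid_word_Cons)
next
  case (neg n u i v p q)
  then show ?case using skein_value.neg[of n "rev v" i "rev u" p q] by (simp add: braid_word_Cons)
qed

lemma conway_rev:
  assumes "braid_word n w"
  shows "conway (braid_closure n (rev w)) = conway (braid_closure n w)"
  using skein_value_unique skein_value_conway[of n "rev w"] assms
    skein_value_rev[OF skein_value_conway[OF assms]] by simp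

section \<open>Independent weights at the crossings\<close>

text \<open>For \<open>x = 0\<close> this exchanges two positions, for \<open>x = 1\<close> it merges both into position \<open>i\<close>, and
for \<open>x = 1 - t\<close> it is the Burau letter.\<close>

definition weighted_letter :: "nat \<Rightarrow> real \<Rightarrow> (nat \<Rightarrow> real) \<Rightarrow> nat \<Rightarrow> real" where
  "weighted_letter i x f = f(i := x * f i + (1 - x) * f (Suc i), Suc i := f i)"

fun weighted_word :: "nat list \<Rightarrow> (nat \<Rightarrow> real) \<Rightarrow> (nat \<Rightarrow> real) \<Rightarrow> nat \<Rightarrow> real" where
  "weighted_word [] x f = f"
| "weighted_word (i # is) x f = weighted_letter i (x 0) (weighted_word is (\<lambda>k. x (Suc k)) f)"

lemma burau_weighted_word: "burau t (map Sigma is) = weighted_word is (\<lambda>_. 1 - t)"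
  by (induction "is") (auto simp: weighted_letter_def fun_eq_iff)

lemma weighted_word_cong:
  "(\<And>k. k < length is \<Longrightarrow> x k = y k) \<Longrightarrow> weighted_word is x = weighted_word is y"
proof (induction "is" arbitrary: x y)
  case (Cons i "is")
  have "weighted_word is (\<lambda>k. x (Suc k)) = weighted_word is (\<lambda>k. y (Suc k))"
    by (rule Cons.IH) (use Cons.prems in auto)
  moreover have "x 0 = y 0" using Cons.prems by simp
  ultimately show ?case by (intro ext) simp
qed auto

lemma weighted_word_affine:
  "k < length is \<Longrightarrow> \<exists>y \<rho>. \<forall>c f. weighted_word is (x(k := c)) f
      = (\<lambda>p. weighted_word is (x(k := 0)) f p + c * y f * \<rho> p)"
proof (induction "is" arbitrary: k x)
  case (Cons i "is")
  show ?case
  proof (cases k)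
    case 0
    define g where "g = weighted_word is (\<lambda>k. x (Suc k))"
    have "weighted_word (i # is) (x(k := c)) f
        = (\<lambda>p. weighted_word (i # is) (x(k := 0)) f p + c * (g f i - g f (Suc i)) * unit_fun i p)" for c f
      by (auto simp: 0 g_def weighted_letter_def unit_fun_def fun_eq_iff algebra_simps)
    then show ?thesis by (intro exI allI)
  next
    case (Suc k')
    then have "k' < length is" using Cons.prems by simp
    from Cons.IH[OF this, of "\<lambda>k. x (Suc k)"] obtain y \<rho> where IH: "\<And>c f. weighted_word is ((\<lambda>k. x (Suc k))(k' := c)) f
        = (\<lambda>p. weighted_word is ((\<lambda>k. x (Suc k))(k' := 0)) f p + c * y f * \<rho> p)"
      by blast
    have shift: "(\<lambda>j. (x(Suc k' := c)) (Suc j)) = (\<lambda>k. x (Suc k))(k' := c)" for c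
      by (auto simp: fun_eq_iff)
    have "weighted_word (i # is) (x(k := c)) f
        = (\<lambda>p. weighted_word (i # is) (x(k := 0)) f p + c * y f * weighted_letter i (x 0) \<rho> p)" for c f
      unfolding Suc weighted_word.simps shift IH[of c]
      by (auto simp: weighted_letter_def fun_eq_iff algebra_simps)
    then show ?thesis by (intro exI allI)
  qed
qed simp

lemma absorbed_det_weighted_affine:
  assumes "k < length is"
  shows "absorbed_det n (weighted_word is (x(k := c)))
    = (1 - c) * absorbed_det n (weighted_word is (x(k := 0)))
      + c * absorbed_det n (weighted_word is (x(k := 1)))"
proof -
  obtain y \<rho> where eq: "\<And>c f. weighted_word is (x(k := c)) f
      = (\<lambda>p. weighted_word is (x(k := 0)) f p + c * y f * \<rho> p)"
    using weighted_word_affine[OF assms] by blast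
  obtain W where W: "\<And>c. absorbed_det n (\<lambda>f p. weighted_word is (x(k := 0)) f p + c * y f * \<rho> p)
      = absorbed_det n (weighted_word is (x(k := 0))) + c * W"
    using absorbed_det_rank_one[of n "weighted_word is (x(k := 0))" y \<rho>] by blast
  have "absorbed_det n (weighted_word is (x(k := c))) = absorbed_det n (weighted_word is (x(k := 0))) + c * W" for c
    unfolding W[symmetric] by (simp add: absorbed_det_def eq[of c])
  from this[of c] this[of 1] show ?thesis by (simp add: algebra_simps)
qed

definition weight_of :: "nat set \<Rightarrow> nat \<Rightarrow> real" where
  "weight_of S k = of_bool (k \<in> S)"

text \<open>A function that is affine in each variable has coefficients given by mixed differences at the corners
of the unit cube; here they are collected by degree on the diagonal.\<close>

lemma multiaffine_diagonal:
  fixes f :: "(nat \<Rightarrow> real) \<Rightarrow> real"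
  assumes "\<And>k x a. k < c \<Longrightarrow> f (x(k := a)) = (1 - a) * f (x(k := 0)) + a * f (x(k := 1))"
  shows "\<exists>P. (\<forall>a. poly P a = f (\<lambda>k. if k < c then a else 0)) \<and>
    coeff P 0 = f (weight_of {}) \<and>
    coeff P 1 = (\<Sum>k<c. f (weight_of {k}) - f (weight_of {})) \<and>
    coeff P 2 = (\<Sum>l<c. \<Sum>k<l. f (weight_of {k, l}) - f (weight_of {k}) - f (weight_of {l}) + f (weight_of {}))"
  using assms
proof (induction c arbitrary: f)
  case 0
  have "(\<lambda>k. 0) = weight_of {}" by (simp add: weight_of_def fun_eq_iff)
  then show ?case by (intro exI[of _ "[:f (weight_of {}):]"]) (simp add: numeral_2_eq_2)
next
  case (Suc c)
  define f' where "f' x = f (x(c := 1))" for x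
  have f'w: "f' (weight_of S) = f (weight_of (insert c S))" for S
    unfolding f'_def by (rule arg_cong[of _ _ f]) (auto simp: weight_of_def fun_eq_iff)
  obtain P where P: "\<And>a. poly P a = f (\<lambda>k. if k < c then a else 0)" "coeff P 0 = f (weight_of {})"
      "coeff P 1 = (\<Sum>k<c. f (weight_of {k}) - f (weight_of {}))"
      "coeff P 2 = (\<Sum>l<c. \<Sum>k<l. f (weight_of {k, l}) - f (weight_of {k}) - f (weight_of {l}) + f (weight_of {}))"
    using Suc.IH[of f, OF Suc.prems[OF less_SucI]] by blast
  have "f' (x(k := a)) = (1 - a) * f' (x(k := 0)) + a * f' (x(k := 1))" if "k < c" for k x a
  proof -
    have "x(k := b, c := 1) = x(c := 1, k := b)" for b
      by (rule fun_upd_twist) (use that in simp)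
    then show ?thesis unfolding f'_def by (simp only:) (rule Suc.prems, use that in simp)
  qed
  from Suc.IH[OF this] obtain P' where P': "\<And>a. poly P' a = f' (\<lambda>k. if k < c then a else 0)"
      "coeff P' 0 = f' (weight_of {})" "coeff P' 1 = (\<Sum>k<c. f' (weight_of {k}) - f' (weight_of {}))"
    by blast
  define R where "R = P + pCons 0 (P' - P)"
  have "poly R a = f (\<lambda>k. if k < Suc c then a else 0)" for a
  proof -
    let ?x = "\<lambda>k. if k < c then a else 0"
    have "(\<lambda>k. if k < Suc c then a else 0) = ?x(c := a)" "?x(c := 0) = ?x"
      by (auto simp: fun_eq_iff)
    then have "f (\<lambda>k. if k < Suc c then a else 0) = (1 - a) * f ?x + a * f' ?x"
      using Suc.prems[of c ?x a] by (simp add: f'_def del: fun_upd_apply)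
    then show ?thesis by (simp add: R_def P P' algebra_simps)
  qed
  moreover have "coeff R 0 = f (weight_of {})" by (simp add: R_def P)
  moreover have "coeff R 1 = (\<Sum>k<Suc c. f (weight_of {k}) - f (weight_of {}))"
    using P P' by (simp add: R_def f'w)
  moreover have "coeff R 2 = (\<Sum>l<Suc c. \<Sum>k<l. f (weight_of {k, l}) - f (weight_of {k}) - f (weight_of {l}) + f (weight_of {}))"
  proof -
    have "coeff R 2 = coeff P 2 + (coeff P' 1 - coeff P 1)"
      by (simp add: R_def numeral_2_eq_2)
    also have "coeff P' 1 - coeff P 1
        = (\<Sum>k<c. f (weight_of {k, c}) - f (weight_of {k}) - f (weight_of {c}) + f (weight_of {}))"
      unfolding P P' f'w by (simp add: sum_subtractf[symmetric] insert_commute) (rule sum.cong, auto)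
    finally show ?thesis by (simp add: P)
  qed
  ultimately show ?case by blast
qed

section \<open>The second-order expansion\<close>

text \<open>Substitute \<open>s = exp (- h)\<close>. The exceptional value \<open>s = 1\<close> is covered by continuity.\<close>

lemma poly_exp_comparison:
  fixes P q :: "real poly" and m :: int and h :: real
  assumes eq: "\<And>s. 0 < s \<Longrightarrow> s \<noteq> 1 \<Longrightarrow> s powi (- m) * poly P (1 - s\<^sup>2) = poly q (1 / s - s)"
  shows "exp (m * h) * poly P (1 - exp (- 2 * h)) = poly q (exp h - exp (- h))"
proof -
  let ?D = "\<lambda>h :: real. exp (m * h) * poly P (1 - exp (- 2 * h)) - poly q (exp h - exp (- h))"
  have off: "?D h = 0" if "h \<noteq> 0" for h
  proof -
    have "exp (- h) powi (- m) = exp (m * h)"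
      by (simp add: exp_power_int)
    moreover have "(exp (- h))\<^sup>2 = exp (- 2 * h)"
      by (simp add: power2_eq_square flip: exp_add)
    moreover have "1 / exp (- h) = exp h" by (simp add: exp_minus field_simps)
    ultimately show ?thesis using eq[of "exp (- h)"] that by simp
  qed
  have "isCont ?D 0" by (intro continuous_intros)
  then have "?D \<midarrow>0\<rightarrow> ?D 0" by (simp add: isCont_def)
  moreover have "eventually (\<lambda>h. ?D h = 0) (at 0)"
    unfolding eventually_at by (intro exI[of _ 1] conjI ballI impI, simp) (rule off, simp)
  then have "?D \<midarrow>0\<rightarrow> 0" by (rule tendsto_eventually)
  ultimately have "?D 0 = 0" by (rule LIM_unique)
  then have "?D h = 0" using off by (cases "h = 0") auto
  then show ?thesis by simp
qed

text \<open>The Taylor coefficients of both sides at \<open>h = 0\<close> up to second order.\<close>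

lemma poly_exp_taylor:
  fixes P q :: "real poly"
  assumes eq: "\<And>h. exp (m * h) * poly P (1 - exp (- 2 * h)) = poly q (exp h - exp (- h))"
  shows "coeff P 0 = coeff q 0"
    and "m * coeff P 0 + 2 * coeff P 1 = 2 * coeff q 1"
    and "m\<^sup>2 * coeff P 0 + 4 * m * coeff P 1 - 4 * coeff P 1 + 8 * coeff P 2 = 8 * coeff q 2"
proof -
  have c: "coeff (pderiv p) 0 = coeff p 1" "coeff (pderiv p) (Suc 0) = 2 * coeff p 2"
    for p :: "real poly"
    by (simp_all add: coeff_pderiv numeral_2_eq_2)
  note c = c poly_0_coeff_0
  show "coeff P 0 = coeff q 0" using eq[of 0] by (simp add: c)
  let ?G1 = "\<lambda>h. exp (m * h) * (m * poly P (1 - exp (- 2 * h)) + 2 * exp (- 2 * h) * poly (pderiv P) (1 - exp (- 2 * h)))"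
  let ?H1 = "\<lambda>h. poly (pderiv q) (exp h - exp (- h)) * (exp h + exp (- h))"
  have "((\<lambda>h. exp (m * h) * poly P (1 - exp (- 2 * h))) has_real_derivative ?G1 h) (at h)" for h
    by (rule derivative_eq_intros refl | simp)+ (simp add: algebra_simps)
  moreover have "((\<lambda>h. poly q (exp h - exp (- h))) has_real_derivative ?H1 h) (at h)" for h
    by (rule derivative_eq_intros refl | simp)+
  ultimately have eq1: "?G1 h = ?H1 h" for h
    unfolding eq by (rule DERIV_unique)
  from eq1[of 0] show "m * coeff P 0 + 2 * coeff P 1 = 2 * coeff q 1"
    by (simp add: c)
  have "(?G1 has_real_derivative (m * (m * coeff P 0 + 2 * coeff P 1)
      + (2 * m * coeff P 1 - 4 * coeff P 1 + 8 * coeff P 2))) (at 0)"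
    by (rule derivative_eq_intros refl | simp)+ (simp add: c algebra_simps)
  moreover have "(?H1 has_real_derivative (8 * coeff q 2)) (at 0)"
    by (rule derivative_eq_intros refl | simp)+ (simp add: c)
  ultimately have "m * (m * coeff P 0 + 2 * coeff P 1)
      + (2 * m * coeff P 1 - 4 * coeff P 1 + 8 * coeff P 2) = 8 * coeff q 2"
    unfolding eq1 by (rule DERIV_unique)
  then show "m\<^sup>2 * coeff P 0 + 4 * m * coeff P 1 - 4 * coeff P 1 + 8 * coeff P 2 = 8 * coeff q 2"
    by (simp add: algebra_simps power2_eq_square)
qed

text \<open>Replacing \<open>s\<close> by \<open>- s\<close> changes the sign of \<open>z\<close> and leaves \<open>t\<close> unchanged, so the Conway polynomial
is even or odd, and it is even because its value at \<open>0\<close> is \<open>D {} = 1\<close>. So its linear coefficient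
vanishes. This identifies the first-order coefficient of the determinant, and the second-order one
then determines that of \<open>z\<^sup>2\<close>.\<close>

lemma v2_positive_braid:
  fixes "is" :: "nat list" and n :: nat
  defines "D \<equiv> \<lambda>S. absorbed_det n (weighted_word is (weight_of S))"
    and "c \<equiv> length is"
  assumes bw: "braid_word n (map Sigma is)" and D0: "D {} = 1"
    and D1: "\<And>k. k < c \<Longrightarrow> D {k} \<in> {0, 1}"
  shows "real_of_int (v2 (braid_closure n (map Sigma is)))
    = (\<Sum>l<c. \<Sum>k<l. D {k, l} - D {k} * D {l})"
proof -
  let ?K = "braid_closure n (map Sigma is)"
  define q :: "real poly" where "q = map_poly of_int (conway ?K)"
  obtain P where P: "\<And>a. poly P a = absorbed_det n (weighted_word is (\<lambda>k. if k < c then a else 0))"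
      "coeff P 0 = D {}" "coeff P 1 = (\<Sum>k<c. D {k} - D {})"
      "coeff P 2 = (\<Sum>l<c. \<Sum>k<l. D {k, l} - D {k} - D {l} + D {})"
    using multiaffine_diagonal[of c "\<lambda>x. absorbed_det n (weighted_word is x)"] absorbed_det_weighted_affine
    unfolding D_def c_def by blast
  define m where "m = int c + 1 - int n"
  have "exponent_sum (map Sigma is) = int c"
    unfolding c_def by (induction "is") auto
  then have val: "conway_value s (n, map Sigma is) = s powi (- m) * poly P (1 - s\<^sup>2)" for s
  proof -
    have "weighted_word is (\<lambda>_. 1 - s\<^sup>2) = weighted_word is (\<lambda>k. if k < c then 1 - s\<^sup>2 else 0)"
      by (rule weighted_word_cong) (simp add: c_def)
    then show ?thesis
      using \<open>exponent_sum _ = _\<close> by (simp add: conway_value_def burau_weighted_word P m_def algebra_simps)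
  qed
  have eq: "s powi (- m) * poly P (1 - s\<^sup>2) = poly q (1 / s - s)" if "s \<noteq> 0" "1 / s \<noteq> s" for s
    using conway_value_eq[OF bw that] by (simp add: val real_eval_def q_def)
  have ne: "1 / s \<noteq> s" if "0 < s" "s \<noteq> 1" for s :: real
  proof
    assume "1 / s = s"
    then have "(s - 1) * (s + 1) = 0" using that by (simp add: field_simps)
    then show False using that by simp
  qed
  have "exp (real_of_int m * h) * poly P (1 - exp (- 2 * h)) = poly q (exp h - exp (- h))" for h
    by (rule poly_exp_comparison) (use eq ne in auto)
  note taylor = poly_exp_taylor[OF this]
  have q0: "coeff q 0 = 1" using taylor(1) by (simp add: P D0)
  define \<sigma> :: real where "\<sigma> = (if even m then 1 else - 1)"
  have "poly q (- z) = \<sigma> * poly q z" if "z \<in> (\<lambda>s. 1 / s - s) ` {0<..<1}" for z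
  proof -
    obtain s where s: "0 < s" "s < 1" and z: "z = 1 / s - s" using \<open>z \<in> _\<close> by auto
    have s_ne: "1 / s \<noteq> s" by (rule ne) (use s in auto)
    then have "1 / (- s) \<noteq> - s" by simp
    then have "(- s) powi (- m) * poly P (1 - s\<^sup>2) = poly q (- z)"
      using eq[of "- s"] s by (simp add: z)
    moreover have "s powi (- m) * poly P (1 - s\<^sup>2) = poly q z"
      using eq[of s] s s_ne by (simp add: z)
    moreover have "(- s) powi (- m) = \<sigma> * s powi (- m)"
      by (simp add: \<sigma>_def power_int_minus_left)
    ultimately show ?thesis by (metis mult.assoc)
  qed
  then have "(\<lambda>s. 1 / s - s) ` {0<..<1} \<subseteq> {z. poly (pcompose q [:0, - 1:] - Polynomial.smult \<sigma> q) z = 0}"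
    by (auto simp: poly_pcompose)
  then have "pcompose q [:0, - 1:] - Polynomial.smult \<sigma> q = 0"
    using infinite_skein_parameters poly_roots_finite finite_subset by blast
  then have par: "(- 1) ^ i * coeff q i = \<sigma> * coeff q i" for i
    by (metis coeff_pcompose_linear coeff_smult right_minus_eq)
  have "\<sigma> = 1" using par[of 0] q0 by simp
  then have q1: "coeff q 1 = 0" using par[of 1] by simp
  \<comment> \<open>By the fact \<open>m\<close> below, \<open>g\<close> is the genus \<open>(c + 1 - n) / 2\<close> of the positive braid knot.\<close>
  define g where "g = (\<Sum>k<c. 1 - D {k})"
  have P1: "coeff P 1 = - g" unfolding P(3) g_def D0 by (simp add: sum_negf[symmetric])
  have m: "real_of_int m = 2 * g" using taylor(2) unfolding P(2) D0 P1 q1 by simp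
  have "8 * coeff q 2 = 8 * coeff P 2 - 4 * (g * g - g)"
    using taylor(3) unfolding P(2) D0 P1 m by (simp add: algebra_simps power2_eq_square)
  moreover have "g * g - g = 2 * (\<Sum>l<c. \<Sum>k<l. (1 - D {k}) * (1 - D {l}))"
  proof -
    have "(\<Sum>k<N. 1 - D {k}) * (\<Sum>k<N. 1 - D {k}) - (\<Sum>k<N. 1 - D {k})
        = 2 * (\<Sum>l<N. \<Sum>k<l. (1 - D {k}) * (1 - D {l}))" if "N \<le> c" for N
      using that
    proof (induction N)
      case (Suc N)
      have "(1 - D {N}) * (1 - D {N}) = 1 - D {N}" using D1[of N] Suc.prems by auto
      moreover have "(x + y) * (x + y) - (x + y) = 2 * (S + x * y)"
        if "x * x - x = 2 * S" "y * y = y" for x y S :: real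
        using that by (simp add: algebra_simps)
      ultimately show ?case
        using Suc.IH Suc.prems by (simp add: sum_distrib_right[symmetric])
    qed simp
    then show ?thesis by (simp add: g_def)
  qed
  ultimately have "coeff q 2 = coeff P 2 - (\<Sum>l<c. \<Sum>k<l. (1 - D {k}) * (1 - D {l}))"
    by simp
  also have "\<dots> = (\<Sum>l<c. \<Sum>k<l. D {k, l} - D {k} * D {l})"
    unfolding P(4) sum_subtractf[symmetric] D0 by (intro sum.cong) (simp_all add: algebra_simps)
  finally show ?thesis by (simp add: v2_def q_def)
qed

section \<open>Determinants of functional graphs\<close>

text \<open>The heights \<open>h\<close> say that every position reaches \<open>1\<close> under \<open>g\<close>. Hence only the identity
contributes to the Leibniz formula: the cycles of any other contributing permutation would be cycles
of \<open>g\<close> that avoid \<open>1\<close>.\<close>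

lemma absorbed_det_downhill:
  fixes h :: "nat \<Rightarrow> nat"
  assumes down: "\<And>p. p \<in> {2..n} \<Longrightarrow> g p = 1 \<or> h (g p) < h p"
  shows "absorbed_det n (\<lambda>f p. f (g p)) = 1"
proof -
  define N where "N = n - 1"
  define A :: "real mat" where "A = mat N N (\<lambda>(i, j). of_bool (i = j) - of_bool (g (Suc (Suc i)) = Suc (Suc j)))"
  have A: "A \<in> carrier_mat N N" by (simp add: A_def)
  have zero: "(\<Prod>i = 0..<N. A $$ (i, \<sigma> i)) = 0" if \<sigma>: "\<sigma> permutes {0..<N}" "\<sigma> \<noteq> id" for \<sigma>
  proof (rule ccontr)
    assume "(\<Prod>i = 0..<N. A $$ (i, \<sigma> i)) \<noteq> 0"
    then have nz: "A $$ (i, \<sigma> i) \<noteq> 0" if "i < N" for i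
      using that by (simp add: prod_zero_iff)
    \<comment> \<open>A moved index of minimal height is mapped by \<open>g\<close> to another moved index, which is lower.\<close>
    define M where "M = {i. \<sigma> i \<noteq> i}"
    have MN: "M \<subseteq> {0..<N}" using \<sigma>(1) unfolding M_def permutes_def by auto
    have "M \<noteq> {}" using \<sigma>(2) by (auto simp: M_def fun_eq_iff)
    moreover have "finite M" using MN finite_subset by blast
    ultimately obtain i where i: "i \<in> M" and min: "\<And>j. j \<in> M \<Longrightarrow> h (Suc (Suc i)) \<le> h (Suc (Suc j))"
      using arg_min_if_finite[of M "\<lambda>i. h (Suc (Suc i))"] by (metis linorder_not_less)
    have iN: "i < N" using i MN by auto
    have "\<sigma> i < N" using \<sigma>(1) iN permutes_in_image[of \<sigma> "{0..<N}" i] by auto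
    moreover have "\<sigma> i \<noteq> i" using i by (simp add: M_def)
    ultimately have g: "g (Suc (Suc i)) = Suc (Suc (\<sigma> i))"
      using nz[OF iN] iN by (auto simp: A_def split: if_splits)
    have "\<sigma> i \<in> M"
      using i permutes_inj[OF \<sigma>(1)] by (auto simp: M_def dest: injD)
    with min have "h (Suc (Suc i)) \<le> h (g (Suc (Suc i)))" by (simp add: g)
    moreover have "Suc (Suc i) \<in> {2..n}" using iN by (auto simp: N_def)
    ultimately show False using down[of "Suc (Suc i)"] g by auto
  qed
  have "absorbed_det n (\<lambda>f p. f (g p)) = det A"
    by (simp add: absorbed_det_def A_def N_def unit_fun_def)
  also have "\<dots> = (\<Sum>\<sigma> | \<sigma> permutes {0..<N}. of_int (sign \<sigma>) * (\<Prod>i = 0..<N. A $$ (i, \<sigma> i)))"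
    by (rule det_def'[OF A])
  also have "\<dots> = (\<Sum>\<sigma>\<in>{id}. of_int (sign \<sigma>) * (\<Prod>i = 0..<N. A $$ (i, \<sigma> i)))"
    by (rule sum.mono_neutral_right) (auto simp: finite_permutations zero permutes_id)
  also have "\<dots> = (\<Prod>i = 0..<N. A $$ (i, i))" by simp
  also have "\<dots> = 1"
  proof (rule prod.neutral, intro ballI)
    fix i assume "i \<in> {0..<N}"
    then have "Suc (Suc i) \<in> {2..n}" by (auto simp: N_def)
    then have "g (Suc (Suc i)) \<noteq> Suc (Suc i)" using down[of "Suc (Suc i)"] by auto
    then show "A $$ (i, i) = 1" using \<open>i \<in> _\<close> by (simp add: A_def)
  qed
  finally show ?thesis .
qed

text \<open>The indicator function of \<open>A\<close> lies in the kernel.\<close>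

lemma absorbed_det_closed_set:
  assumes "A \<subseteq> {2..n}" "A \<noteq> {}" and closed: "\<And>p. p \<in> {2..n} \<Longrightarrow> p \<in> A \<longleftrightarrow> g p \<in> A"
  shows "absorbed_det n (\<lambda>f p. f (g p)) = 0"
proof -
  define v :: "nat \<Rightarrow> real" where "v j = of_bool (Suc (Suc j) \<in> A)" for j
  have le: "j < n - 1" if "Suc (Suc j) \<in> A" for j using that assms(1) by auto
  obtain a where "a \<in> A" using assms(2) by auto
  then have "2 \<le> a" using assms(1) by auto
  define k where "k = a - 2"
  have a: "a = Suc (Suc k)" using \<open>2 \<le> a\<close> by (simp add: k_def)
  show ?thesis
    unfolding absorbed_det_def
  proof (rule det_eq_0_kernel[where v = v and k = k])
    fix i assume i: "i < n - 1"
    let ?q = "g (Suc (Suc i))"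
    have "(\<Sum>j<n - 1. of_bool (i = j) * v j) = (\<Sum>j<n - 1. if j = i then v i else 0)"
      by (intro sum.cong) auto
    then have 1: "(\<Sum>j<n - 1. of_bool (i = j) * v j) = v i" using i by simp
    have "(\<Sum>j<n - 1. unit_fun (Suc (Suc j)) ?q * v j)
        = (\<Sum>j<n - 1. if j = ?q - 2 then of_bool (?q \<in> A) else 0)"
    proof (rule sum.cong[OF HOL.refl])
      fix j
      have "?q \<in> A \<Longrightarrow> Suc (Suc (?q - 2)) = ?q" using assms(1) by force
      then show "unit_fun (Suc (Suc j)) ?q * v j = (if j = ?q - 2 then of_bool (?q \<in> A) else 0)"
        by (auto simp: unit_fun_def v_def)
    qed
    also have "\<dots> = of_bool (?q \<in> A)"
    proof -
      have "?q \<in> A \<Longrightarrow> ?q - 2 < n - 1" using assms(1) by fastforce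
      then show ?thesis by auto
    qed
    also have "\<dots> = v i"
      using closed[of "Suc (Suc i)"] i by (auto simp: v_def)
    finally show "(\<Sum>j<n - 1. (of_bool (i = j) - unit_fun (Suc (Suc j)) ?q) * v j) = 0"
      using 1 by (simp add: left_diff_distrib sum_subtractf)
  qed (use \<open>a \<in> A\<close> a le in \<open>auto simp: v_def\<close>)
qed

text \<open>Either all positions reach \<open>1\<close>, or those that do not form a set as in the previous lemma.\<close>

lemma absorbed_det_function_01:
  assumes g: "\<And>p. p \<in> {1..n} \<Longrightarrow> g p \<in> {1..n}"
  shows "absorbed_det n (\<lambda>f p. f (g p)) \<in> {0, 1}"
proof -
  define R where "R p \<longleftrightarrow> (\<exists>m. (g ^^ m) p = 1)" for p
  have step: "\<exists>m'. m = Suc m' \<and> (g ^^ m') (g p) = 1" if "(g ^^ m) p = 1" "p \<noteq> 1" for m p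
    using that by (cases m) (auto simp: funpow_swap1)
  show ?thesis
  proof (cases "\<forall>p\<in>{2..n}. R p")
    case True
    define h where "h p = (LEAST m. (g ^^ m) p = 1)" for p
    have "absorbed_det n (\<lambda>f p. f (g p)) = 1"
    proof (rule absorbed_det_downhill[where h = h])
      fix p assume p: "p \<in> {2..n}"
      then have "\<exists>m. (g ^^ m) p = 1" using True by (auto simp: R_def)
      then have "(g ^^ h p) p = 1" unfolding h_def by (rule LeastI_ex)
      moreover have "p \<noteq> 1" using p by auto
      ultimately obtain m where m: "h p = Suc m" "(g ^^ m) (g p) = 1" using step by blast
      have "h (g p) \<le> m" unfolding h_def by (rule Least_le) (rule m(2))
      then show "g p = 1 \<or> h (g p) < h p" using m(1) by simp
    qed
    then show ?thesis by simp
  next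
    case False
    have RR: "R p \<longleftrightarrow> R (g p)" if "p \<noteq> 1" for p
    proof
      assume "R p" then show "R (g p)" using step that by (auto simp: R_def)
    next
      assume "R (g p)"
      then obtain m where "(g ^^ m) (g p) = 1" by (auto simp: R_def)
      then have "(g ^^ Suc m) p = 1" by (simp add: funpow_swap1)
      then show "R p" unfolding R_def by blast
    qed
    have R1: "R 1" unfolding R_def by (rule exI[of _ 0]) simp
    have "absorbed_det n (\<lambda>f p. f (g p)) = 0"
    proof (rule absorbed_det_closed_set[where A = "{p\<in>{2..n}. \<not> R p}"])
      fix p assume p: "p \<in> {2..n}"
      then have "g p \<in> {1..n}" by (intro g) auto
      moreover have "g p \<noteq> 1" if "\<not> R (g p)" using that R1 by auto
      ultimately show "p \<in> {p\<in>{2..n}. \<not> R p} \<longleftrightarrow> g p \<in> {p\<in>{2..n}. \<not> R p}"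
        using RR[of p] p by (auto simp: Suc_le_eq numeral_2_eq_2)
    qed (use False in auto)
    then show ?thesis by simp
  qed
qed

section \<open>Strands and resolved crossings\<close>

text \<open>The position at which a strand leaves when the crossings in \<open>S\<close> merge their two strands into the left
position and the others are ordinary crossings.\<close>

fun resolve :: "nat list \<Rightarrow> nat set \<Rightarrow> nat \<Rightarrow> nat" where
  "resolve [] S = id"
| "resolve (i # is) S = resolve is {k. Suc k \<in> S} \<circ>
     (if 0 \<in> S then (\<lambda>p. if p = Suc i then i else p) else transpose i (Suc i))"

text \<open>Strands are named by the position at which they enter the braid. This is the strand that comes from
the left into crossing \<open>k\<close>.\<close>

fun left_strand :: "nat list \<Rightarrow> nat \<Rightarrow> nat" where
  "left_strand [] k = 0"
| "left_strand (i # is) 0 = i"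
| "left_strand (i # is) (Suc k) = transpose i (Suc i) (left_strand is k)"

fun right_strand :: "nat list \<Rightarrow> nat \<Rightarrow> nat" where
  "right_strand [] k = 0"
| "right_strand (i # is) 0 = Suc i"
| "right_strand (i # is) (Suc k) = transpose i (Suc i) (right_strand is k)"

abbreviation strand_perm :: "nat list \<Rightarrow> nat \<Rightarrow> nat" where
  "strand_perm is \<equiv> braid_perm (map Sigma is)"

definition divert :: "nat \<Rightarrow> nat \<Rightarrow> nat \<Rightarrow> nat" where
  "divert a b p = (if p = a then b else p)"

lemma weighted_word_resolve:
  "weighted_word is (weight_of S) f = (\<lambda>p. f (resolve is S p))"
proof (induction "is" arbitrary: S)
  case (Cons i "is")
  have "(\<lambda>k. weight_of S (Suc k)) = weight_of {k. Suc k \<in> S}"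
    by (simp add: weight_of_def fun_eq_iff)
  then have "weighted_word is (\<lambda>k. weight_of S (Suc k)) f = (\<lambda>p. f (resolve is {k. Suc k \<in> S} p))"
    by (simp add: Cons.IH)
  then show ?case
    unfolding weighted_word.simps by (auto simp: weighted_letter_def weight_of_def fun_eq_iff transpose_def)
qed simp

lemma resolve_empty: "resolve is {} = strand_perm is"
  by (induction "is") auto

lemma transpose_eq_flip: "transpose a b p = q \<longleftrightarrow> p = transpose a b q"
  by (auto simp: transpose_def)

text \<open>Merging at crossing \<open>k\<close> sends the left strand along the path of the right one. The crossings in \<open>S\<close>
come later, hence the diversion at \<open>k\<close> is applied first.\<close>

lemma resolve_insert:
  "k < length is \<Longrightarrow> (\<And>l. l \<in> S \<Longrightarrow> k < l) \<Longrightarrow>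
    resolve is (insert k S) = resolve is S \<circ> divert (left_strand is k) (right_strand is k)"
proof (induction "is" arbitrary: k S)
  case (Cons i "is")
  show ?case
  proof (cases k)
    case 0
    then have "0 \<notin> S" using Cons.prems(2) by blast
    moreover have "{k. Suc k \<in> insert 0 S} = {k. Suc k \<in> S}" by auto
    ultimately show ?thesis using 0
      by (auto simp: fun_eq_iff divert_def transpose_def)
  next
    case (Suc k')
    have "0 \<notin> S" using Cons.prems(2) Suc by blast
    moreover have "{l. Suc l \<in> insert (Suc k') S} = insert k' {l. Suc l \<in> S}" by auto
    moreover have "resolve is (insert k' {l. Suc l \<in> S})
        = resolve is {l. Suc l \<in> S} \<circ> divert (left_strand is k') (right_strand is k')"
      by (rule Cons.IH) (use Cons.prems Suc in auto)
    ultimately show ?thesis using Suc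
      by (auto simp: fun_eq_iff divert_def transpose_eq_flip)
  qed
qed simp

definition crossings_below :: "nat \<Rightarrow> nat list \<Rightarrow> bool" where
  "crossings_below n is \<longleftrightarrow> (\<forall>i\<in>set is. 1 \<le> i \<and> i < n)"

lemma crossings_below_simps [simp]:
  "crossings_below n []" "crossings_below n (i # is) \<longleftrightarrow> 1 \<le> i \<and> i < n \<and> crossings_below n is"
  by (auto simp: crossings_below_def)

lemma transpose_in_range:
  "1 \<le> i \<Longrightarrow> i < n \<Longrightarrow> p \<in> {1..n} \<Longrightarrow> transpose i (Suc i) p \<in> {1..n}"
  by (auto simp: transpose_def)

lemma strands_in_range:
  "crossings_below n is \<Longrightarrow> k < length is \<Longrightarrow> left_strand is k \<in> {1..n} \<and> right_strand is k \<in> {1..n}"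
proof (induction "is" arbitrary: k)
  case (Cons i "is")
  show ?case
  proof (cases k)
    case 0
    then show ?thesis using Cons.prems by simp
  next
    case (Suc k')
    then have "left_strand is k' \<in> {1..n} \<and> right_strand is k' \<in> {1..n}"
      using Cons by simp
    then show ?thesis
      using Suc Cons.prems transpose_in_range[of i n] by simp
  qed
qed simp

lemma strands_distinct: "k < length is \<Longrightarrow> left_strand is k \<noteq> right_strand is k"
proof (induction "is" arbitrary: k)
  case (Cons i "is")
  then show ?case by (cases k) (auto dest: injD[OF inj_transpose])
qed simp

lemma strand_perm_in_range:
  "crossings_below n is \<Longrightarrow> p \<in> {1..n} \<Longrightarrow> strand_perm is p \<in> {1..n}"
proof (induction "is" arbitrary: p)
  case (Cons i "is")
  then show ?case using transpose_in_range[of i n p] by simp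
qed simp

text \<open>Each crossing of the two strands exchanges their order, so the net number of exchanges is the change of
order between entry and exit.\<close>

lemma crossing_balance:
  assumes "p \<noteq> q"
  shows "(\<Sum>k<length is. of_bool (left_strand is k = p \<and> right_strand is k = q))
      - (\<Sum>k<length is. of_bool (left_strand is k = q \<and> right_strand is k = p))
    = (of_bool (strand_perm is q < strand_perm is p) - of_bool (q < p) :: int)"
  using assms
proof (induction "is" arbitrary: p q)
  case (Cons i "is")
  let ?t = "transpose i (Suc i)"
  have "?t p \<noteq> ?t q" using Cons.prems by (simp add: transpose_eq_flip)
  note IH = Cons.IH[OF this]
  have "of_bool (?t q < ?t p) - of_bool (q < p)
      = (of_bool (i = p \<and> Suc i = q) - of_bool (i = q \<and> Suc i = p) :: int)"
    using Cons.prems by (auto simp: transpose_def)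
  then show ?case using IH
    unfolding list.size add_0_right add_Suc_right sum.lessThan_Suc_shift
    by (simp add: transpose_eq_flip sum.lessThan_Suc_shift del: sum.lessThan_Suc)
qed simp

section \<open>Strands in the order of the knot\<close>

text \<open>The label of a strand is the number of strands that the knot runs through before it, starting with the
strand at position \<open>1\<close>.\<close>

definition strand_labels :: "nat \<Rightarrow> (nat \<Rightarrow> nat) \<Rightarrow> (nat \<Rightarrow> nat) \<Rightarrow> bool" where
  "strand_labels n \<pi> lab \<longleftrightarrow> bij_betw lab {1..n} {..<n} \<and> lab 1 = 0 \<and>
     (\<forall>p\<in>{1..n}. \<pi> p \<in> {1..n} \<and> lab (\<pi> p) = (if Suc (lab p) = n then 0 else Suc (lab p)))"

lemma strand_labelsD:
  assumes "strand_labels n \<pi> lab"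
  shows "bij_betw lab {1..n} {..<n}" "lab 1 = 0" "p \<in> {1..n} \<Longrightarrow> \<pi> p \<in> {1..n}"
    "p \<in> {1..n} \<Longrightarrow> lab (\<pi> p) = (if Suc (lab p) = n then 0 else Suc (lab p))"
    "p \<in> {1..n} \<Longrightarrow> lab p < n"
    "p \<in> {1..n} \<Longrightarrow> q \<in> {1..n} \<Longrightarrow> lab p = lab q \<longleftrightarrow> p = q"
proof -
  show bij: "bij_betw lab {1..n} {..<n}" and "lab 1 = 0"
    and "p \<in> {1..n} \<Longrightarrow> \<pi> p \<in> {1..n}"
    and "p \<in> {1..n} \<Longrightarrow> lab (\<pi> p) = (if Suc (lab p) = n then 0 else Suc (lab p))"
    using assms by (simp_all add: strand_labels_def)
  show "p \<in> {1..n} \<Longrightarrow> lab p < n" using bij_betwE[OF bij] by blast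
  show "p \<in> {1..n} \<Longrightarrow> q \<in> {1..n} \<Longrightarrow> lab p = lab q \<longleftrightarrow> p = q"
    using inj_on_eq_iff[OF bij_betw_imp_inj_on[OF bij]] by blast
qed

lemma strand_label_0_iff:
  assumes "strand_labels n \<pi> lab" "p \<in> {1..n}"
  shows "lab p = 0 \<longleftrightarrow> p = 1"
proof -
  have "1 \<in> {1..n}" using assms(2) by auto
  then show ?thesis using strand_labelsD(6)[OF assms(1) assms(2), of 1] strand_labelsD(2)[OF assms(1)] by simp
qed

text \<open>Following \<open>\<rho>\<close> and then \<open>\<pi>\<close> increases the label until the walk returns to position \<open>1\<close>.\<close>

lemma absorbed_det_forward:
  assumes L: "strand_labels n \<pi> lab"
    and \<rho>: "\<And>p. p \<in> {1..n} \<Longrightarrow> \<rho> p \<in> {1..n} \<and> lab p \<le> lab (\<rho> p)"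
  shows "absorbed_det n (\<lambda>f p. f (\<pi> (\<rho> p))) = 1"
proof (rule absorbed_det_downhill[where h = "\<lambda>p. n - lab p"])
  fix p assume "p \<in> {2..n}"
  then have p: "p \<in> {1..n}" by auto
  note q = \<rho>[OF p, THEN conjunct1]
  note \<pi>q = strand_labelsD(3)[OF L q]
  show "\<pi> (\<rho> p) = 1 \<or> n - lab (\<pi> (\<rho> p)) < n - lab p"
    using strand_labelsD(4)[OF L q] strand_label_0_iff[OF L \<pi>q] strand_labelsD(5)[OF L \<pi>q] \<rho>[OF p]
    by (auto split: if_splits)
qed

text \<open>A diversion from \<open>a\<close> back to \<open>b\<close> closes a cycle through the labels from \<open>lab b + 1\<close> to \<open>lab a\<close>.
Everything with a positive label up to \<open>lab a\<close> is trapped in it.\<close>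

lemma absorbed_det_backward:
  assumes L: "strand_labels n \<pi> lab" and ab: "a \<in> {1..n}" "b \<in> {1..n}" "lab b < lab a"
  shows "absorbed_det n (\<lambda>f p. f (\<pi> (divert a b p))) = 0"
proof (rule absorbed_det_closed_set[where A = "{p \<in> {2..n}. lab p \<le> lab a}"])
  have "a \<noteq> 1" using ab strand_labelsD(2)[OF L] by auto
  then show "{p \<in> {2..n}. lab p \<le> lab a} \<noteq> {}" using ab(1) by auto
  fix p assume p2: "p \<in> {2..n}"
  then have p: "p \<in> {1..n}" by auto
  have in2: "q \<in> {2..n} \<longleftrightarrow> lab q \<noteq> 0" if "q \<in> {1..n}" for q
    using that strand_label_0_iff[OF L that] by auto
  show "p \<in> {p \<in> {2..n}. lab p \<le> lab a} \<longleftrightarrow> \<pi> (divert a b p) \<in> {p \<in> {2..n}. lab p \<le> lab a}"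
  proof (cases "p = a")
    case True
    have "lab (\<pi> b) = Suc (lab b)"
      using strand_labelsD(4)[OF L ab(2)] strand_labelsD(5)[OF L ab(1)] ab(3) by auto
    then have "\<pi> b \<in> {p \<in> {2..n}. lab p \<le> lab a}"
      using in2[OF strand_labelsD(3)[OF L ab(2)]] ab(3) by simp
    then show ?thesis using True p2 by (simp add: divert_def)
  next
    case False
    then have "lab p \<noteq> lab a" using strand_labelsD(6)[OF L p ab(1)] by simp
    then show ?thesis
      using False p2 in2[OF strand_labelsD(3)[OF L p]] strand_labelsD(4)[OF L p] strand_labelsD(5)[OF L ab(1)]
      by (auto simp: divert_def split: if_splits)
  qed
qed auto

section \<open>Backtracking pairs of crossings\<close>

text \<open>The same two strands meet at both crossings with exchanged sides, and the diversion at \<open>k\<close> goes back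
to the earlier strand.\<close>

definition backtrack :: "(nat \<Rightarrow> nat) \<Rightarrow> nat list \<Rightarrow> nat \<Rightarrow> nat \<Rightarrow> bool" where
  "backtrack lab is k l \<longleftrightarrow> left_strand is k = right_strand is l \<and> right_strand is k = left_strand is l \<and>
     lab (right_strand is k) < lab (left_strand is k)"

text \<open>The summand of \<open>v2_positive_braid\<close> for \<open>k < l\<close> is nonnegative: if both diversions go forward, then
so does their composition. At a backtracking pair the diversion at \<open>k\<close> alone is backward, so
\<open>D {k} = 0\<close>, but the diversion at \<open>l\<close> undoes it: the left strand of \<open>k\<close> is sent to the right
strand of \<open>k\<close> and then back to itself. So \<open>D {k, l} = 1\<close>.\<close>

lemma v2_ge_backtracks:
  assumes cb: "crossings_below n is" and n: "1 \<le> n" and L: "strand_labels n (strand_perm is) lab"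
  shows "(\<Sum>l<length is. \<Sum>k<l. of_bool (backtrack lab is k l))
    \<le> real_of_int (v2 (braid_closure n (map Sigma is)))"
proof -
  let ?c = "length is"
  let ?a = "left_strand is" and ?b = "right_strand is"
  define D where "D S = absorbed_det n (weighted_word is (weight_of S))" for S
  have D: "D S = absorbed_det n (\<lambda>f p. f (resolve is S p))" for S
    by (simp add: D_def absorbed_det_def weighted_word_resolve)
  have range: "?a k \<in> {1..n}" "?b k \<in> {1..n}" if "k < ?c" for k
    using strands_in_range[OF cb that] by auto
  have lab_ne: "lab (?a k) \<noteq> lab (?b k)" if "k < ?c" for k
    using strand_labelsD(6)[OF L range[OF that]] strands_distinct[OF that] by simp
  have res1: "resolve is {k} = strand_perm is \<circ> divert (?a k) (?b k)" if "k < ?c" for k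
    using resolve_insert[OF that, of "{}"] by (simp add: resolve_empty)
  have res2: "resolve is {k, l} = strand_perm is \<circ> divert (?a l) (?b l) \<circ> divert (?a k) (?b k)"
    if "k < l" "l < ?c" for k l
    using resolve_insert[of k "is" "{l}"] res1[of l] that by simp
  have D0: "D {} = 1"
    using absorbed_det_forward[OF L, of "\<lambda>p. p"] by (simp add: D resolve_empty)
  have D1: "D {k} = of_bool (lab (?a k) < lab (?b k))" if k: "k < ?c" for k
  proof (cases "lab (?a k) < lab (?b k)")
    case True
    have "absorbed_det n (\<lambda>f p. f (strand_perm is (divert (?a k) (?b k) p))) = 1"
      by (rule absorbed_det_forward[OF L]) (use True range[OF k] in \<open>auto simp: divert_def\<close>)
    then show ?thesis using True by (simp add: D res1[OF k])
  next
    case False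
    then have "lab (?b k) < lab (?a k)" using lab_ne[OF k] by simp
    from absorbed_det_backward[OF L range[OF k] this] show ?thesis
      using False by (simp add: D res1[OF k])
  qed
  have resolve_range: "resolve is S p \<in> {1..n}" if "p \<in> {1..n}" "crossings_below n is" for S p "is"
    using that
  proof (induction "is" arbitrary: S p)
    case (Cons i "is")
    have "(if 0 \<in> S then if p = Suc i then i else p else transpose i (Suc i) p) \<in> {1..n}"
      using Cons.prems transpose_in_range[of i n p] by auto
    from Cons.IH[OF this, of "{k. Suc k \<in> S}"] Cons.prems(2)
    have "resolve is {k. Suc k \<in> S} (if 0 \<in> S then if p = Suc i then i else p else transpose i (Suc i) p) \<in> {1..n}"
      by simp
    moreover have "resolve (i # is) S p = resolve is {k. Suc k \<in> S}
        (if 0 \<in> S then if p = Suc i then i else p else transpose i (Suc i) p)" by simp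
    ultimately show ?case by (simp only:)
  qed simp
  have D01: "D S \<in> {0, 1}" for S
    unfolding D by (rule absorbed_det_function_01) (rule resolve_range[OF _ cb])
  have bound: "of_bool (backtrack lab is k l) \<le> D {k, l} - D {k} * D {l}" if kl: "k < l" "l < ?c" for k l
  proof -
    have k: "k < ?c" using kl by simp
    note R = range[OF k] range[OF kl(2)]
    have fwd: "D {k, l} = 1"
      if "\<And>p. p \<in> {1..n} \<Longrightarrow> lab p \<le> lab (divert (?a l) (?b l) (divert (?a k) (?b k) p))"
    proof -
      have "absorbed_det n (\<lambda>f p. f (strand_perm is (divert (?a l) (?b l) (divert (?a k) (?b k) p)))) = 1"
        by (rule absorbed_det_forward[OF L]) (use that R in \<open>auto simp: divert_def\<close>)
      then show ?thesis by (simp add: D res2[OF kl])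
    qed
    consider "backtrack lab is k l" | "\<not> backtrack lab is k l" "D {k} = 1" "D {l} = 1"
      | "\<not> backtrack lab is k l" "D {k} * D {l} = 0"
      using D01[of "{k}"] D01[of "{l}"] by auto
    then show ?thesis
    proof cases
      case 1
      then have "D {k, l} = 1" by (intro fwd) (auto simp: backtrack_def divert_def)
      moreover have "lab (?b k) < lab (?a k)" using 1 unfolding backtrack_def by blast
      then have "D {k} = 0" using D1[OF k] by simp
      ultimately show ?thesis by simp
    next
      case 2
      then have "lab (?a k) < lab (?b k)" "lab (?a l) < lab (?b l)"
        using D1[OF k] D1[OF kl(2)] by (auto split: if_splits)
      then have "D {k, l} = 1" by (intro fwd) (auto simp: divert_def)
      then show ?thesis using 2 by simp
    next
      case 3
      then show ?thesis using D01[of "{k, l}"] by auto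
    qed
  qed
  have bw: "braid_word n (map Sigma is)"
    using cb n by (auto simp: braid_word_def crossings_below_def)
  have "(\<Sum>l<?c. \<Sum>k<l. of_bool (backtrack lab is k l)) \<le> (\<Sum>l<?c. \<Sum>k<l. D {k, l} - D {k} * D {l})"
    by (intro sum_mono bound) auto
  also have "\<dots> = real_of_int (v2 (braid_closure n (map Sigma is)))"
    unfolding D_def by (rule v2_positive_braid[OF bw, symmetric]) (use D0 D01 in \<open>auto simp: D_def\<close>)
  finally show ?thesis .
qed

lemma braid_perm_append: "braid_perm (u @ v) = braid_perm v \<circ> braid_perm u"
  by (induction u) auto

section \<open>Backtracking pairs in the reversed word\<close>

lemma strand_perm_rev_cancel: "strand_perm (rev is) (strand_perm is p) = p"
  by (induction "is" arbitrary: p) (simp_all add: braid_perm_append)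

lemma strands_append:
  "k < length us \<Longrightarrow> left_strand (us @ [i]) k = left_strand us k"
  "k < length us \<Longrightarrow> right_strand (us @ [i]) k = right_strand us k"
proof (induction us arbitrary: k)
  case (Cons j us)
  { case 1 then show ?case using Cons.IH(1) by (cases k) auto }
  { case 2 then show ?case using Cons.IH(2) by (cases k) auto }
qed auto

lemma strands_last:
  "left_strand (us @ [i]) (length us) = strand_perm (rev us) i"
  "right_strand (us @ [i]) (length us) = strand_perm (rev us) (Suc i)"
  by (induction us) (auto simp: braid_perm_append)

text \<open>Read backwards, a crossing has its left and right strand exchanged, and a strand is named by the
position at which it used to leave.\<close>

lemma strands_rev:
  "k < length is \<Longrightarrow> left_strand (rev is) (length is - Suc k) = strand_perm is (right_strand is k)"
  "k < length is \<Longrightarrow> right_strand (rev is) (length is - Suc k) = strand_perm is (left_strand is k)"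
proof (induction "is" arbitrary: k)
  case (Cons i "is")
  { case 1
    show ?case
    proof (cases k)
      case 0
      then show ?thesis using strands_last(1)[of "rev is" i] by simp
    next
      case (Suc k')
      then show ?thesis using 1 Cons.IH(1)[of k']
        by (simp add: strands_append)
    qed }
  { case 2
    show ?case
    proof (cases k)
      case 0
      then show ?thesis using strands_last(2)[of "rev is" i] by simp
    next
      case (Suc k')
      then show ?thesis using 2 Cons.IH(2)[of k']
        by (simp add: strands_append)
    qed }
qed auto

text \<open>The reversed knot starts at position \<open>1\<close> as well and meets the other strands in reverse order.\<close>

definition reverse_labels :: "nat \<Rightarrow> (nat \<Rightarrow> nat) \<Rightarrow> nat \<Rightarrow> nat" where
  "reverse_labels n lab p = (if lab p = 0 then 0 else n - lab p)"

lemma reverse_labels_shift: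
  assumes "strand_labels n \<pi> lab" "p \<in> {1..n}"
  shows "reverse_labels n lab (\<pi> p) = n - Suc (lab p)"
  using strand_labelsD(4,5)[OF assms] by (auto simp: reverse_labels_def)

lemma strand_labels_reverse:
  assumes cb: "crossings_below n is" and L: "strand_labels n (strand_perm is) lab"
  shows "strand_labels n (strand_perm (rev is)) (reverse_labels n lab)"
proof -
  have cbr: "crossings_below n (rev is)" using cb by (simp add: crossings_below_def)
  let ?\<pi> = "strand_perm is" and ?r = "reverse_labels n lab"
  have inj: "inj_on ?r {1..n}"
  proof (rule inj_onI)
    fix p q assume pq: "p \<in> {1..n}" "q \<in> {1..n}" "?r p = ?r q"
    then have "lab p = lab q"
      using strand_labelsD(5)[OF L pq(1)] strand_labelsD(5)[OF L pq(2)]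
      by (auto simp: reverse_labels_def split: if_splits)
    then show "p = q" using strand_labelsD(6)[OF L pq(1,2)] by simp
  qed
  have "?r ` {1..n} \<subseteq> {..<n}"
    using strand_labelsD(5)[OF L] by (auto simp: reverse_labels_def)
  moreover have "card (?r ` {1..n}) = card {..<n}" using card_image[OF inj] by simp
  ultimately have "?r ` {1..n} = {..<n}" by (intro card_subset_eq) auto
  moreover have "?r 1 = 0" using strand_labelsD(2)[OF L] by (simp add: reverse_labels_def)
  moreover have "?r (strand_perm (rev is) q) = (if Suc (?r q) = n then 0 else Suc (?r q))" if q: "q \<in> {1..n}" for q
  proof -
    define p where "p = strand_perm (rev is) q"
    have p: "p \<in> {1..n}" unfolding p_def by (rule strand_perm_in_range[OF cbr q])
    have "q = ?\<pi> p" using strand_perm_rev_cancel[of "rev is" q] by (simp add: p_def)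
    then have "?r q = n - Suc (lab p)" using reverse_labels_shift[OF L p] by simp
    then show ?thesis
      using strand_labelsD(5)[OF L p] unfolding p_def[symmetric] by (auto simp: reverse_labels_def)
  qed
  ultimately show ?thesis
    unfolding strand_labels_def bij_betw_def using inj strand_perm_in_range[OF cbr] by blast
qed

text \<open>Three reversals take place: of the order of the crossings, of left and right, and of the labels. The
last two cancel, so that the pair occurs in the other order.\<close>

lemma backtrack_rev:
  assumes cb: "crossings_below n is" and L: "strand_labels n (strand_perm is) lab"
    and "k < length is" "l < length is"
  shows "backtrack (reverse_labels n lab) (rev is) (length is - Suc k) (length is - Suc l) \<longleftrightarrow> backtrack lab is k l"
proof -
  have inj: "strand_perm is p = strand_perm is q \<longleftrightarrow> p = q" for p q
    using strand_perm_rev_cancel by metis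
  have r: "left_strand is k \<in> {1..n}" "right_strand is k \<in> {1..n}"
    using strands_in_range[OF cb assms(3)] by auto
  have "lab (left_strand is k) < n" using strand_labelsD(5)[OF L r(1)] .
  moreover have "lab (right_strand is k) < n" using strand_labelsD(5)[OF L r(2)] .
  ultimately show ?thesis
    unfolding backtrack_def strands_rev[OF assms(3)] strands_rev[OF assms(4)] inj
      reverse_labels_shift[OF L r(1)] reverse_labels_shift[OF L r(2)] by auto
qed

text \<open>The word itself accounts for the pairs with \<open>k < l\<close>, the reversed word for those with \<open>l < k\<close>.\<close>

lemma v2_ge_all_backtracks:
  assumes cb: "crossings_below n is" and n: "1 \<le> n" and L: "strand_labels n (strand_perm is) lab"
  shows "(\<Sum>k<length is. \<Sum>l<length is. of_bool (backtrack lab is k l))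
    \<le> 2 * real_of_int (v2 (braid_closure n (map Sigma is)))"
proof -
  let ?c = "length is"
  let ?X = "\<lambda>k l. of_bool (backtrack lab is k l) :: real"
  let ?Y = "\<lambda>k l. of_bool (backtrack (reverse_labels n lab) (rev is) k l) :: real"
  have cbr: "crossings_below n (rev is)" using cb by (simp add: crossings_below_def)
  have bw: "braid_word n (map Sigma is)"
    using cb n by (auto simp: braid_word_def crossings_below_def)
  have "(\<Sum>l<?c. \<Sum>k<l. ?Y k l) \<le> real_of_int (v2 (braid_closure n (map Sigma (rev is))))"
    using v2_ge_backtracks[OF cbr n strand_labels_reverse[OF cb L]] by simp
  also have "v2 (braid_closure n (map Sigma (rev is))) = v2 (braid_closure n (map Sigma is))"
    using conway_rev[OF bw] by (simp add: v2_def rev_map)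
  also have "(\<Sum>l<?c. \<Sum>k<l. ?Y k l) = (\<Sum>(l, k)\<in>(SIGMA l:{..<?c}. {..<l}). ?Y k l)"
    by (rule sum.Sigma) auto
  also have "\<dots> = (\<Sum>(l, k)\<in>(SIGMA l:{..<?c}. {l<..<?c}). ?X k l)"
  proof (rule sum.reindex_bij_witness[of _ "\<lambda>(l, k). (?c - Suc l, ?c - Suc k)" "\<lambda>(l, k). (?c - Suc l, ?c - Suc k)"])
    fix x assume "x \<in> (SIGMA l:{..<?c}. {..<l})"
    then obtain l k where x: "x = (l, k)" "k < l" "l < ?c" by auto
    then have "?X (?c - Suc k) (?c - Suc l) = ?Y k l"
      using backtrack_rev[OF cb L, of "?c - Suc k" "?c - Suc l"] by (simp add: Suc_diff_Suc)
    then show "(case (case x of (l, k) \<Rightarrow> (?c - Suc l, ?c - Suc k)) of (l, k) \<Rightarrow> ?X k l) = (case x of (l, k) \<Rightarrow> ?Y k l)"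
      by (simp add: x)
  qed auto
  also have "\<dots> = (\<Sum>l<?c. \<Sum>k\<in>{l<..<?c}. ?X k l)"
    by (rule sum.Sigma[symmetric]) auto
  finally have 2: "(\<Sum>l<?c. \<Sum>k\<in>{l<..<?c}. ?X k l) \<le> real_of_int (v2 (braid_closure n (map Sigma is)))" .
  have "(\<Sum>k<?c. ?X k l) = (\<Sum>k<l. ?X k l) + (\<Sum>k\<in>{l<..<?c}. ?X k l)" if "l < ?c" for l
  proof -
    have split: "{..<?c} = insert l ({..<l} \<union> {l<..<?c})" using that by auto
    have "?X l l = 0" by (simp add: backtrack_def)
    then show ?thesis
      unfolding split by (subst sum.insert, simp, simp, subst sum.union_disjoint) auto
  qed
  then have "(\<Sum>l<?c. \<Sum>k<?c. ?X k l) = (\<Sum>l<?c. \<Sum>k<l. ?X k l) + (\<Sum>l<?c. \<Sum>k\<in>{l<..<?c}. ?X k l)"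
    by (simp add: sum.distrib)
  then show ?thesis
    using 2 v2_ge_backtracks[OF cb n L] by (subst sum.swap) simp
qed

section \<open>Counting crossings\<close>

definition crossing_count :: "nat list \<Rightarrow> nat \<Rightarrow> nat \<Rightarrow> real" where
  "crossing_count is p q = (\<Sum>k<length is. of_bool (left_strand is k = p \<and> right_strand is k = q))"

lemma crossing_count_balanced:
  assumes "p \<noteq> q"
  shows "(crossing_count is p q - crossing_count is q p)\<^sup>2 \<le> 1"
proof -
  have "crossing_count is p q - crossing_count is q p
      = real_of_int (of_bool (strand_perm is q < strand_perm is p) - of_bool (q < p))"
    unfolding crossing_balance[OF assms, symmetric] crossing_count_def by simp
  then show ?thesis by simp
qed

lemma card_ordered_pairs:
  assumes "strand_labels n \<pi> lab"
  shows "2 * card {(p, q). p \<in> {1..n} \<and> q \<in> {1..n} \<and> lab q < lab p} + n = n * n"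
proof -
  note bij = strand_labelsD(1)[OF assms]
  have eq: "{(p, q). p \<in> {1..n} \<and> q \<in> {1..n} \<and> lab q < lab p} = (SIGMA p:{1..n}. {q \<in> {1..n}. lab q < lab p})"
    by auto
  have "card {q \<in> {1..n}. lab q < lab p} = lab p" if p: "p \<in> {1..n}" for p
  proof -
    have "lab ` {q \<in> {1..n}. lab q < lab p} = {..<lab p}"
    proof (intro equalityI subsetI)
      fix i assume i: "i \<in> {..<lab p}"
      then have "i \<in> lab ` {1..n}"
        using bij_betw_imp_surj_on[OF bij] strand_labelsD(5)[OF assms p] by auto
      then show "i \<in> lab ` {q \<in> {1..n}. lab q < lab p}" using i by auto
    qed auto
    moreover have "inj_on lab {q \<in> {1..n}. lab q < lab p}"
      by (rule inj_on_subset[OF bij_betw_imp_inj_on[OF bij]]) auto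
    ultimately show ?thesis by (metis card_image card_lessThan)
  qed
  then have "card {(p, q). p \<in> {1..n} \<and> q \<in> {1..n} \<and> lab q < lab p} = (\<Sum>p\<in>{1..n}. lab p)"
    unfolding eq by (subst card_SigmaI) auto
  also have "\<dots> = (\<Sum>i<n. i)"
    by (rule sum.reindex_bij_betw[OF bij, of "\<lambda>i. i"])
  finally have "card {(p, q). p \<in> {1..n} \<and> q \<in> {1..n} \<and> lab q < lab p} = (\<Sum>i<n. i)" .
  moreover have "2 * (\<Sum>i<n. i) + n = n * n" by (induction n) auto
  ultimately show ?thesis by (simp only:)
qed

lemma sum_power2_le_card:
  fixes f :: "'a \<Rightarrow> real"
  assumes "finite A" shows "(sum f A)\<^sup>2 \<le> card A * (\<Sum>x\<in>A. (f x)\<^sup>2)"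
proof (cases "A = {}")
  case False
  let ?N = "real (card A)" and ?S = "sum f A"
  have N: "?N > 0" using assms False by (simp add: card_gt_0_iff)
  have "0 \<le> (\<Sum>x\<in>A. (?N * f x - ?S)\<^sup>2)" by (intro sum_nonneg) simp
  also have "\<dots> = (\<Sum>x\<in>A. ?N\<^sup>2 * (f x)\<^sup>2 - 2 * ?N * ?S * f x + ?S\<^sup>2)"
    by (intro sum.cong) (simp_all add: power2_diff power_mult_distrib mult_ac)
  also have "\<dots> = ?N\<^sup>2 * (\<Sum>x\<in>A. (f x)\<^sup>2) - 2 * ?N * ?S * ?S + ?N * ?S\<^sup>2"
    by (simp only: sum.distrib sum_subtractf sum_distrib_left[symmetric] sum_constant)
  also have "\<dots> = ?N * (?N * (\<Sum>x\<in>A. (f x)\<^sup>2) - ?S\<^sup>2)"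
    by (simp add: algebra_simps power2_eq_square)
  finally show ?thesis using N by (simp add: zero_le_mult_iff)
qed simp

text \<open>The sum over all ordered pairs of crossings splits into products of crossing counts, one for each pair
of strands; \<open>Q\<close> lists the pairs of strands with the later one first.\<close>

lemma sum_backtracks_ge:
  assumes cb: "crossings_below n is" and n: "2 \<le> n" and L: "strand_labels n (strand_perm is) lab"
  shows "(real (length is))\<^sup>2 / (n * (n - 1) / 2) - n * (n - 1) / 2
    \<le> 4 * (\<Sum>k<length is. \<Sum>l<length is. of_bool (backtrack lab is k l))"
proof -
  let ?c = "length is" and ?a = "left_strand is" and ?b = "right_strand is"
  define Q where "Q = {(p, q). p \<in> {1..n} \<and> q \<in> {1..n} \<and> lab q < lab p}"
  have finQ: "finite Q"
    by (rule finite_subset[of _ "{1..n} \<times> {1..n}"]) (auto simp: Q_def)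
  have Q_ne: "p \<noteq> q" if "(p, q) \<in> Q" for p q using that by (auto simp: Q_def)
  have range: "?a k \<in> {1..n}" "?b k \<in> {1..n}" if "k < ?c" for k
    using strands_in_range[OF cb that] by auto
  have delta: "(\<Sum>(p, q)\<in>Q. of_bool (x = p \<and> y = q) * f p q) = of_bool ((x, y) \<in> Q) * (f x y :: real)" for x y f
  proof -
    have "(\<Sum>(p, q)\<in>Q. of_bool (x = p \<and> y = q) * f p q) = (\<Sum>z\<in>Q. if z = (x, y) then f x y else 0)"
      by (intro sum.cong) auto
    then show ?thesis using finQ by simp
  qed
  let ?m = "\<lambda>p q. crossing_count is p q"
  have bt: "of_bool (backtrack lab is k l)
      = (\<Sum>(p, q)\<in>Q. of_bool (?a k = p \<and> ?b k = q) * of_bool (?a l = q \<and> ?b l = p) :: real)"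
    if "k < ?c" for k l
  proof -
    have "(?a k, ?b k) \<in> Q \<longleftrightarrow> lab (?b k) < lab (?a k)" using range[OF that] by (simp add: Q_def)
    then show ?thesis unfolding delta by (auto simp: backtrack_def)
  qed
  have "(\<Sum>k<?c. \<Sum>l<?c. of_bool (backtrack lab is k l))
      = (\<Sum>k<?c. \<Sum>l<?c. \<Sum>(p, q)\<in>Q. of_bool (?a k = p \<and> ?b k = q) * of_bool (?a l = q \<and> ?b l = p) :: real)"
    by (intro sum.cong) (auto simp: bt)
  also have "\<dots> = (\<Sum>k<?c. \<Sum>(p, q)\<in>Q. \<Sum>l<?c. of_bool (?a k = p \<and> ?b k = q) * of_bool (?a l = q \<and> ?b l = p))"
    by (subst sum.swap) (simp add: case_prod_unfold)
  also have "\<dots> = (\<Sum>(p, q)\<in>Q. \<Sum>k<?c. \<Sum>l<?c. of_bool (?a k = p \<and> ?b k = q) * of_bool (?a l = q \<and> ?b l = p))"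
    by (subst sum.swap) (simp add: case_prod_unfold)
  also have "\<dots> = (\<Sum>(p, q)\<in>Q. ?m p q * ?m q p)"
    unfolding crossing_count_def sum_product by (rule HOL.refl)
  finally have Z: "(\<Sum>k<?c. \<Sum>l<?c. of_bool (backtrack lab is k l)) = (\<Sum>(p, q)\<in>Q. ?m p q * ?m q p)" .
  have "real ?c = (\<Sum>k<?c. 1)" by simp
  also have "\<dots> = (\<Sum>k<?c. \<Sum>(p, q)\<in>Q. of_bool (?a k = p \<and> ?b k = q) + of_bool (?a k = q \<and> ?b k = p))"
  proof (rule sum.cong)
    fix k assume "k \<in> {..<?c}"
    then have k: "k < ?c" by simp
    have "lab (?a k) \<noteq> lab (?b k)"
      using strand_labelsD(6)[OF L range[OF k]] strands_distinct[OF k] by simp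
    then have "1 = of_bool ((?a k, ?b k) \<in> Q) + (of_bool ((?b k, ?a k) \<in> Q) :: real)"
      using range[OF k] by (auto simp: Q_def)
    also have "\<dots> = (\<Sum>(p, q)\<in>Q. of_bool (?a k = p \<and> ?b k = q)) + (\<Sum>(p, q)\<in>Q. of_bool (?a k = q \<and> ?b k = p))"
      using delta[of "?a k" "?b k" "\<lambda>_ _. 1"] delta[of "?b k" "?a k" "\<lambda>_ _. 1"]
      by (simp add: conj_commute)
    finally show "1 = (\<Sum>(p, q)\<in>Q. of_bool (?a k = p \<and> ?b k = q) + (of_bool (?a k = q \<and> ?b k = p) :: real))"
      by (simp add: sum.distrib case_prod_unfold)
  qed simp
  also have "\<dots> = (\<Sum>(p, q)\<in>Q. ?m p q + ?m q p)"
    by (subst sum.swap) (simp add: crossing_count_def sum.distrib case_prod_unfold)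
  finally have c: "real ?c = (\<Sum>(p, q)\<in>Q. ?m p q + ?m q p)" .
  have "(\<Sum>(p, q)\<in>Q. (?m p q + ?m q p)\<^sup>2 - 1) \<le> (\<Sum>(p, q)\<in>Q. 4 * (?m p q * ?m q p))"
  proof (rule sum_mono, clarify)
    fix p q assume "(p, q) \<in> Q"
    from crossing_count_balanced[OF Q_ne[OF this], of "is"]
    show "(?m p q + ?m q p)\<^sup>2 - 1 \<le> 4 * (?m p q * ?m q p)"
      by (simp add: power2_eq_square algebra_simps)
  qed
  then have 1: "(\<Sum>(p, q)\<in>Q. (?m p q + ?m q p)\<^sup>2) - card Q \<le> 4 * (\<Sum>k<?c. \<Sum>l<?c. of_bool (backtrack lab is k l))"
    unfolding Z by (simp add: sum_subtractf sum_distrib_left case_prod_unfold)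
  have 2: "(real ?c)\<^sup>2 \<le> card Q * (\<Sum>(p, q)\<in>Q. (?m p q + ?m q p)\<^sup>2)"
    using sum_power2_le_card[OF finQ, of "\<lambda>(p, q). ?m p q + ?m q p"] unfolding c
    by (simp add: case_prod_unfold)
  have "2 * card Q + n = n * n"
    using card_ordered_pairs[OF L] by (simp add: Q_def)
  then have "2 * real (card Q) + n = real n * n"
    by (metis of_nat_add of_nat_mult of_nat_numeral)
  then have cQ: "real (card Q) = real n * (real n - 1) / 2" by (simp add: algebra_simps)
  moreover have "real n * (real n - 1) / 2 > 0" using n by simp
  ultimately have "card Q > 0" using of_nat_0_less_iff by metis
  then have "(real ?c)\<^sup>2 / card Q \<le> (\<Sum>(p, q)\<in>Q. (?m p q + ?m q p)\<^sup>2)"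
    using 2 by (simp add: divide_le_eq mult.commute)
  then show ?thesis using 1 n unfolding cQ by (simp add: of_nat_diff)
qed

text \<open>The closure is a knot iff the permutation is a single cycle; the labels count the steps from position
\<open>1\<close> along it.\<close>

lemma ex_strand_labels:
  assumes cb: "crossings_below n is" and n: "1 \<le> n" and knot: "closure_is_knot n (map Sigma is)"
  shows "\<exists>lab. strand_labels n (strand_perm is) lab"
proof -
  let ?\<pi> = "strand_perm is"
  have inj: "inj ?\<pi>" by (rule inj_on_inverseI[of _ "strand_perm (rev is)"]) (simp add: strand_perm_rev_cancel)
  have perm: "?\<pi> permutes {1..n}"
  proof (rule bij_imp_permutes)
    have "?\<pi> ` {1..n} \<subseteq> {1..n}" using strand_perm_in_range[OF cb] by auto
    then show "bij_betw ?\<pi> {1..n} {1..n}"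
      using inj_on_subset[OF inj] by (simp add: bij_betw_def endo_inj_surj)
    show "?\<pi> x = x" if "x \<notin> {1..n}" for x
      using cb that
    proof (induction "is")
      case (Cons i "is")
      then have "transpose i (Suc i) x = x" by (auto simp: transpose_def)
      then show ?case using Cons by simp
    qed simp
  qed
  have perm': "permutation ?\<pi>" using perm permutation_permutes by blast
  let ?O = "orbit ?\<pi>"
  have self: "p \<in> ?O p" for p by (rule permutation_self_in_orbit[OF perm'])
  have "?O 1 = {1..n}"
  proof
    show "?O 1 \<subseteq> {1..n}"
      by (rule permutes_orbit_subset[OF perm]) (use n in auto)
    obtain X where "?O ` {1..n} = {X}"
      using knot unfolding closure_is_knot_def by (auto simp: card_1_singleton_iff)
    moreover have "1 \<in> {1..n}" using n by simp
    ultimately have "?O p = ?O 1" if "p \<in> {1..n}" for p using that by (metis imageI singletonD)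
    then show "{1..n} \<subseteq> ?O 1" using self by blast
  qed
  define e where "e m = (?\<pi> ^^ m) 1" for m
  define d where "d = funpow_dist1 ?\<pi> 1 1"
  have "inj_on e {0..<d}"
    unfolding e_def d_def by (rule inj_on_funpow_dist1[OF self])
  moreover have img: "e ` {0..<d} = {1..n}"
    using orbit_conv_funpow_dist1[OF self[of 1]] \<open>?O 1 = {1..n}\<close> by (simp add: e_def d_def)
  ultimately have "d = n" using card_image[of e "{0..<d}"] by simp
  with \<open>inj_on e {0..<d}\<close> img have bij: "bij_betw e {0..<n} {1..n}" by (simp add: bij_betw_def)
  have en: "e n = 1"
    unfolding e_def \<open>d = n\<close>[symmetric] d_def by (rule funpow_dist1_prop[OF self])
  define lab where "lab = the_inv_into {0..<n} e"
  have lab_e: "lab (e m) = m" if "m < n" for m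
    unfolding lab_def by (rule the_inv_into_f_f[OF bij_betw_imp_inj_on[OF bij]]) (use that in simp)
  have "bij_betw lab {1..n} {..<n}"
    unfolding lab_def lessThan_atLeast0 by (rule bij_betw_the_inv_into[OF bij])
  moreover have "lab 1 = 0" using lab_e[of 0] n by (simp add: e_def)
  moreover have "lab (?\<pi> p) = (if Suc (lab p) = n then 0 else Suc (lab p))" if p: "p \<in> {1..n}" for p
  proof -
    have "p \<in> e ` {0..<n}" using bij_betw_imp_surj_on[OF bij] p by simp
    then obtain m where m: "m < n" "p = e m" by auto
    have "?\<pi> p = e (Suc m)" by (simp add: m e_def)
    then show ?thesis
      using m lab_e[of m] lab_e[of "Suc m"] lab_e[of 0] en n by (auto simp: e_def)
  qed
  ultimately have "strand_labels n ?\<pi> lab"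
    unfolding strand_labels_def using strand_perm_in_range[OF cb] by blast
  then show ?thesis by blast
qed

theorem theorem8p2:
  fixes n :: nat and \<beta> :: "letter list"
  assumes "n \<ge> 2"
    and "braid_word n \<beta>"
    and "positive_word \<beta>"
    and "closure_is_knot n \<beta>"
  shows "real_of_int (v2 (braid_closure n \<beta>)) \<ge>
      (real_of_int (exponent_sum \<beta>))\<^sup>2 / (4 * real n * (real n - 1))
      - (2 * real n - 3) * (real n - 1) / 8"
proof -
  define ks where "ks = map letter_index \<beta>"
  have "Sigma (letter_index l) = l" if "l \<in> set \<beta>" for l
    using assms(3) that by (cases l) (auto simp: positive_word_def)
  then have \<beta>: "\<beta> = map Sigma ks" by (simp add: ks_def map_idI comp_def)
  have cb: "crossings_below n ks"
    using assms(2) by (auto simp: ks_def crossings_below_def braid_word_def)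
  have es: "exponent_sum \<beta> = int (length ks)"
    unfolding \<beta> by (induction ks) auto
  obtain lab where L: "strand_labels n (strand_perm ks) lab"
    using ex_strand_labels[OF cb] assms(1,4) \<beta> by auto
  let ?c = "real (length ks)" and ?N = "real n" and ?v = "real_of_int (v2 (braid_closure n \<beta>))"
  have "?c\<^sup>2 / (?N * (?N - 1) / 2) - ?N * (?N - 1) / 2 \<le> 8 * ?v"
    using sum_backtracks_ge[OF cb assms(1) L] v2_ge_all_backtracks[OF cb _ L] assms(1)
    unfolding \<beta> by (simp add: of_nat_diff)
  moreover have "?c\<^sup>2 / (?N * (?N - 1) / 2) = 8 * (?c\<^sup>2 / (4 * ?N * (?N - 1)))"
  proof -
    have "x / (y / 2) = 8 * (x / (4 * y))" for x y :: real by (simp add: field_simps)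
    then show ?thesis by (simp only: mult.assoc)
  qed
  moreover have "?N * (?N - 1) / 2 \<le> (2 * ?N - 3) * (?N - 1)"
    using mult_right_mono[of "?N / 2" "2 * ?N - 3" "?N - 1"] assms(1) by simp
  moreover have "x' - z / 8 \<le> v" if "x - y \<le> 8 * v" "x = 8 * x'" "y \<le> z" for x x' y z v :: real
    using that by simp
  ultimately have "?c\<^sup>2 / (4 * ?N * (?N - 1)) - (2 * ?N - 3) * (?N - 1) / 8 \<le> ?v" by blast
  then show ?thesis by (simp add: es)
qed

end
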